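(* For any convex lattice polygon $P$ in the plane, the following are equivalent: (1) $P$ can be dissected into lattice triangles of area $1$; (2) $P$ can be dissected into lattice triangles of integer area; (3) $P$ can be diagonally dissected into lattice triangles of integer area; (4) the boundary word of $P$ is contractible. Moreover, there is a linear-time algorithm (linear in the number $n$ of vertices of $P$) that decides, given $P$, whether or not (1)-(4) hold.
   Context: A lattice point is a point of $\mathbb{Z}^2$. A lattice polygon is a polygon in $\mathbb{R}^2$ (with its interior) all of whose vertices are lattice points; a lattice triangle is a lattice polygon that is a triangle. The vertices of a polygon are its corners. Dissection: to dissect a polygon $P$ into triangles is to express $P$ as a union of finitely many (nondegenerate) triangles whose interiors do not overlap. Triangles need not meet edge-to-edge, and vertices of the triangles need not be vertices of $P$. A diagonal dissection of a convex polygon is a dissection into triangles obtained by drawing diagonals of $P$, without introducing any new vertices (every vertex of every triangle is a vertex of $P$). Colors: the color (parity) of a lattice point is one of the four symbols $A=(\text{even},\text{even})$, $B=(\text{odd},\text{even})$, $C=(\text{odd},\text{odd})$, $D=(\text{even},\text{odd})$, according to the parities of its two coordinates. Words: a cyclic word $(X_1X_2\ldots X_n)$ is a finite string of letters considered up to cyclic permutation; indices are taken modulo $n$. The boundary word of a lattice polygon $P$ is the cyclic word obtained by recording the colors of the vertices of $P$ in counterclockwise order. For a cyclic word $(X_1\ldots X_n)$ with $n\ge 2$, a contracting step is: if the letters $X_{i-1},X_i,X_{i+1}$ are not all distinct (as letters), delete $X_i$ from the word. A cyclic word is contractible if there is a (possibly empty) sequence of contracting steps starting with it that results in a word $(X)$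 consisting of a single letter. Computation model: $P$ is given by its list of vertices in counterclockwise order; reading the color of a vertex (which depends only on the least significant bit of each coordinate) and comparing two colors each count as one elementary step. *)

theory Defs
  imports "HOL-Analysis.Analysis"
begin

section \<open>Lattice polygons and dissections\<close>

definition pt :: "int \<times> int \<Rightarrow> real^2" where
  "pt z = vector [of_int (fst z), of_int (snd z)]"

text \<open>The corners of a convex set.\<close>

definition vertices :: "(real^2) set \<Rightarrow> (real^2) set" where
  "vertices S = {v. v extreme_point_of S}"

definition convex_lattice_polygon :: "(real^2) set \<Rightarrow> bool" where
  "convex_lattice_polygon P \<longleftrightarrow>
     polytope P \<and> interior P \<noteq> {} \<and> vertices P \<subseteq> range pt"

definition triangle :: "(real^2) set \<Rightarrow> bool" where
  "triangle T \<longleftrightarrow> (\<exists>a b c. \<not> collinear {a, b, c} \<and> T = convex hull {a, b, c})"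

definition lattice_triangle :: "(real^2) set \<Rightarrow> bool" where
  "lattice_triangle T \<longleftrightarrow> triangle T \<and> vertices T \<subseteq> range pt"

definition area :: "(real^2) set \<Rightarrow> real" where
  "area S = measure lborel S"

definition dissection :: "(real^2) set \<Rightarrow> (real^2) set set \<Rightarrow> bool" where
  "dissection P \<T> \<longleftrightarrow>
     finite \<T> \<and> (\<forall>T\<in>\<T>. triangle T) \<and> \<Union>\<T> = P \<and>
     pairwise (\<lambda>S T. interior S \<inter> interior T = {}) \<T>"

definition diagonals :: "(real^2) set \<Rightarrow> (real^2) set set" where
  "diagonals P = {closed_segment a b | a b.
     a \<in> vertices P \<and> b \<in> vertices P \<and> a \<noteq> b \<and> \<not> closed_segment a b edge_of P}"

text \<open>
  The last conjunct says that the lines of the figure are the boundary of \<open>P\<close>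
  together with some diagonals of \<open>P\<close>.
\<close>

definition diagonal_dissection :: "(real^2) set \<Rightarrow> (real^2) set set \<Rightarrow> bool" where
  "diagonal_dissection P \<T> \<longleftrightarrow>
     dissection P \<T> \<and> (\<forall>T\<in>\<T>. vertices T \<subseteq> vertices P) \<and>
     (\<exists>\<D> \<subseteq> diagonals P. (\<Union>T\<in>\<T>. frontier T) = frontier P \<union> \<Union>\<D>)"

definition unit_area_dissectable :: "(real^2) set \<Rightarrow> bool" where
  "unit_area_dissectable P \<longleftrightarrow>
     (\<exists>\<T>. dissection P \<T> \<and> (\<forall>T\<in>\<T>. lattice_triangle T \<and> area T = 1))"

definition integer_area_dissectable :: "(real^2) set \<Rightarrow> bool" where
  "integer_area_dissectable P \<longleftrightarrow>
     (\<exists>\<T>. dissection P \<T> \<and> (\<forall>T\<in>\<T>. lattice_triangle T \<and> area T \<in> \<int>))"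

definition integer_area_diagonally_dissectable :: "(real^2) set \<Rightarrow> bool" where
  "integer_area_diagonally_dissectable P \<longleftrightarrow>
     (\<exists>\<T>. diagonal_dissection P \<T> \<and> (\<forall>T\<in>\<T>. lattice_triangle T \<and> area T \<in> \<int>))"

section \<open>Boundary words\<close>

text \<open>Positive iff \<open>p\<close> lies strictly to the left of the directed line from \<open>a\<close> to \<open>b\<close>.\<close>

definition orient :: "real^2 \<Rightarrow> real^2 \<Rightarrow> real^2 \<Rightarrow> real" where
  "orient a b p = (b$1 - a$1) * (p$2 - a$2) - (b$2 - a$2) * (p$1 - a$1)"

text \<open>
  For a convex polygon \<open>P\<close>, \<open>vs\<close> lists each corner exactly once, and \<open>P\<close> lies to the left of
  the directed segment from each corner to the (cyclically) next one. Hence each such segment is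
  an edge traversed counterclockwise, so \<open>vs\<close> is determined up to the choice of its first entry.
\<close>

definition ccw_vertex_list :: "(real^2) set \<Rightarrow> (int \<times> int) list \<Rightarrow> bool" where
  "ccw_vertex_list P vs \<longleftrightarrow>
     distinct vs \<and> pt ` set vs = vertices P \<and>
     (\<forall>i < length vs. \<forall>p\<in>P. 0 \<le> orient (pt (vs ! i)) (pt (vs ! (Suc i mod length vs))) p)"

datatype color = A | B | C | D

definition color_of :: "int \<times> int \<Rightarrow> color" where
  "color_of z =
     (if even (fst z) then (if even (snd z) then A else D)
      else (if even (snd z) then B else C))"

text \<open>
  A cyclic word is represented by any of the strings that spell it. Indices are cyclic, so steps
  from different representatives of the same cyclic word yield representatives of the same words.
\<close>

definition boundary_word :: "(int \<times> int) list \<Rightarrow> color list" where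
  "boundary_word vs = map color_of vs"

inductive contracting_step :: "'a list \<Rightarrow> 'a list \<Rightarrow> bool" where
  "\<lbrakk>2 \<le> length w; i < length w;
    \<not> distinct [w ! ((i + length w - 1) mod length w), w ! i, w ! (Suc i mod length w)]\<rbrakk>
   \<Longrightarrow> contracting_step w (take i w @ drop (Suc i) w)"

definition contractible_word :: "'a list \<Rightarrow> bool" where
  "contractible_word w \<longleftrightarrow> (\<exists>X. contracting_step\<^sup>*\<^sup>* w [X])"

section \<open>Machine model\<close>

text \<open>
  A unit-cost random access machine with finitely many instructions, natural-number registers and
  an indirectly addressed memory. The only arithmetic is increment and decrement, so no value
  can exceed the sum of the input length, the number of executed steps and a constant. The
  vertex list is read-only and is accessed solely through the colors of its entries; colors are
  handled through the codes below, so that \<open>JumpEq\<close> compares colors as well as numbers.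
\<close>

fun color_code :: "color \<Rightarrow> nat" where
  "color_code A = 0"
| "color_code B = 1"
| "color_code C = 2"
| "color_code D = 3"

datatype instr =
    Clear nat
  | Inc nat
  | Dec nat
  | Move nat nat
  | Load nat nat
  | Store nat nat
  | ReadColor nat nat
  | JumpEq nat nat nat
  | Accept
  | Reject

text \<open>The arguments of \<open>Running\<close> are the program counter, the registers and the memory.\<close>

datatype config =
    Running nat "nat \<Rightarrow> nat" "nat \<Rightarrow> nat"
  | Halted bool

text \<open>Reading the color of a nonexistent vertex makes the machine loop.\<close>

fun exec :: "(int \<times> int) list \<Rightarrow> instr \<Rightarrow> nat \<Rightarrow> (nat \<Rightarrow> nat) \<Rightarrow> (nat \<Rightarrow> nat) \<Rightarrow> config" where
  "exec vs (Clear r) pc R M = Running (Suc pc) (R(r := 0)) M"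
| "exec vs (Inc r) pc R M = Running (Suc pc) (R(r := R r + 1)) M"
| "exec vs (Dec r) pc R M = Running (Suc pc) (R(r := R r - 1)) M"
| "exec vs (Move r s) pc R M = Running (Suc pc) (R(r := R s)) M"
| "exec vs (Load r s) pc R M = Running (Suc pc) (R(r := M (R s))) M"
| "exec vs (Store r s) pc R M = Running (Suc pc) R (M(R r := R s))"
| "exec vs (ReadColor r s) pc R M =
     (if R s < length vs then Running (Suc pc) (R(r := color_code (color_of (vs ! R s)))) M
      else Running pc R M)"
| "exec vs (JumpEq r s l) pc R M = Running (if R r = R s then l else Suc pc) R M"
| "exec vs Accept pc R M = Halted True"
| "exec vs Reject pc R M = Halted False"

fun step :: "instr list \<Rightarrow> (int \<times> int) list \<Rightarrow> config \<Rightarrow> config" where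
  "step prog vs (Running pc R M) =
     (if pc < length prog then exec vs (prog ! pc) pc R M else Running pc R M)"
| "step prog vs (Halted b) = Halted b"

text \<open>Register 0 initially holds the number of vertices.\<close>

definition initial_config :: "(int \<times> int) list \<Rightarrow> config" where
  "initial_config vs = Running 0 ((\<lambda>_. 0)(0 := length vs)) (\<lambda>_. 0)"

definition halts_within :: "instr list \<Rightarrow> (int \<times> int) list \<Rightarrow> nat \<Rightarrow> bool \<Rightarrow> bool" where
  "halts_within prog vs t b \<longleftrightarrow> (step prog vs ^^ t) (initial_config vs) = Halted b"

end

theory Submission
  imports Defs
begin

text \<open>
  A lattice triangle has integer area iff two of its corners have the same color, so contracting
  steps cut ears of integer area off the polygon, and a contractible boundary word yields a
  diagonal dissection.

  Conversely, contractibility of a word means that the closed walk it spells in the complete graph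
  on the colors is null-homotopic, i.e. has trivial holonomy in a free group. The lattice points
  on a lattice line have at most two colors, so this holonomy can be transported along the sides
  of the triangles independently of how the sides are subdivided, and it is trivial around a
  triangle of integer area since its boundary colors span a star. These local potentials glue to a
  global one on the convex polygon, so the holonomy of the boundary word is trivial.

  Finally, the corners of a triangle of integer area lie in an affine sublattice of index 2; a
  unimodular dissection with respect to it has pieces of area 1. The linear-time algorithm freely
  reduces the boundary word with a stack.
\<close>

section \<open>Holonomy of words\<close>

text \<open>The difficulty is that the triangles need not meet edge to edge: corners of some lie
  inside sides of others, so there is no cell complex across whose faces the boundary walk could be
  contracted. Signed counts along edges would cope with subdivided sides, but they live in an
  abelian group, where nontrivial commutators vanish although the words spelling them are not
  contractible. Non-commutative values, in turn, cannot be summed over the triangles in any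
  canonical order. Hence the transport is phrased through potentials defined at every real point of
  every triangle. Two of them have to agree, up to a constant added on the left, only on the
  intersection of their triangles, and this makes sense for T-junctions as well. Convexity of the
  polygon is what turns the local constants into a global potential.\<close>

typedef 'a bijection = "{f :: 'a \<Rightarrow> 'a. bij f}"
  by (rule exI[of _ id]) simp

setup_lifting type_definition_bijection

text \<open>\<open>group_add\<close> does not assume commutativity, so composition is written as
  \<open>+\<close> and the order of summands matters throughout. Permutations satisfy the group laws
  at once, which spares a quotient construction of the free group.\<close>

instantiation bijection :: (type) group_add
begin

lift_definition zero_bijection :: "'a bijection" is id
  by simp

lift_definition plus_bijection :: "'a bijection \<Rightarrow> 'a bijection \<Rightarrow> 'a bijection" is "(\<circ>)"
  by (rule bij_comp)

lift_definition uminus_bijection :: "'a bijection \<Rightarrow> 'a bijection" is "inv"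
  by (rule bij_imp_bij_inv)

lift_definition minus_bijection :: "'a bijection \<Rightarrow> 'a bijection \<Rightarrow> 'a bijection"
  is "\<lambda>f g. f \<circ> inv g"
  by (simp add: bij_comp bij_imp_bij_inv)

instance
  by standard (transfer; simp add: o_assoc bij_is_inj)+

end

text \<open>
  The free group on the edges of the complete graph on the letters is realised by its left action
  on freely reduced lists of oriented edges, where \<open>(y, x)\<close> is the inverse of \<open>(x, y)\<close>.
\<close>

definition freely_reduced :: "('a \<times> 'a) list \<Rightarrow> bool" where
  "freely_reduced es \<longleftrightarrow>
     successively (\<lambda>e e'. e' \<noteq> prod.swap e) es \<and> (\<forall>e\<in>set es. fst e \<noteq> snd e)"

text \<open>Left multiplication by the generator \<open>e\<close>. Degenerate edges and lists that
  are not freely reduced act trivially or are fixed, so that the map is a bijection of the whole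
  list type and no subtype of reduced lists has to be formed.\<close>

definition edge_act :: "'a \<times> 'a \<Rightarrow> ('a \<times> 'a) list \<Rightarrow> ('a \<times> 'a) list" where
  "edge_act e es =
     (if fst e = snd e \<or> \<not> freely_reduced es then es
      else if es \<noteq> [] \<and> hd es = prod.swap e then tl es else e # es)"

lemma freely_reduced_edge_act: "freely_reduced es \<Longrightarrow> freely_reduced (edge_act e es)"
  by (cases es; cases "tl es") (auto simp: edge_act_def freely_reduced_def)

text \<open>Reducedness matters in the cancelling case: once \<open>e\<close> has removed the head
  \<open>prod.swap e\<close>, the next entry cannot be \<open>e\<close>, so the inverse edge is put
  back instead of cancelling again.\<close>

lemma edge_act_swap: "edge_act (prod.swap e) (edge_act e es) = es"
proof (cases "fst e = snd e \<or> \<not> freely_reduced es")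
  case False
  then have "freely_reduced (edge_act e es)"
    by (simp add: freely_reduced_edge_act)
  with False show ?thesis
    by (cases e; cases es; cases "tl es")
      (auto simp: edge_act_def freely_reduced_def split: if_splits)
qed (auto simp: edge_act_def)

lemma bij_edge_act: "bij (edge_act e)"
  by (rule o_bij[of "edge_act (prod.swap e)"])
    (use edge_act_swap[of e] edge_act_swap[of "prod.swap e"] in \<open>auto simp: fun_eq_iff\<close>)

lift_definition gen :: "'a \<Rightarrow> 'a \<Rightarrow> ('a \<times> 'a) list bijection" is "\<lambda>x y. edge_act (x, y)"
  by (rule bij_edge_act)

lemma gen_same [simp]: "gen x x = 0"
  by transfer (auto simp: edge_act_def)

lemma gen_inverse [simp]: "gen x y + gen y x = 0"
  by transfer (use edge_act_swap[of "(y, x)" for x y] in \<open>auto simp: fun_eq_iff\<close>)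

lemma gen_swap: "- gen x y = gen y x"
  by (simp add: minus_unique)

text \<open>The algebraic form of a contracting step: a detour through \<open>y\<close> is replaced
  by the direct edge when it is stationary at one end or backtracks.\<close>

lemma gen_add: "\<not> distinct [x, y, z] \<Longrightarrow> gen x y + gen y z = gen x z"
  by auto

lemma Rep_bijection_add: "Rep_bijection (f + g) es = Rep_bijection f (Rep_bijection g es)"
  by (simp add: plus_bijection.rep_eq)

section \<open>Holonomy of open walks and the normal form of reduced walks\<close>

fun holonomy :: "'a list \<Rightarrow> ('a \<times> 'a) list bijection" where
  "holonomy (x # y # w) = gen x y + holonomy (y # w)"
| "holonomy w = 0"

lemma holonomy_append:
  "u \<noteq> [] \<Longrightarrow> v \<noteq> [] \<Longrightarrow> holonomy (u @ v) = holonomy u + gen (last u) (hd v) + holonomy v"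
proof (induction u rule: holonomy.induct)
  case (1 x y w)
  then show ?case by (simp add: add.assoc)
qed (cases v; auto)+

fun reduced_walk :: "'a list \<Rightarrow> bool" where
  "reduced_walk (x # y # w) \<longleftrightarrow> x \<noteq> y \<and> (w \<noteq> [] \<longrightarrow> x \<noteq> hd w) \<and> reduced_walk (y # w)"
| "reduced_walk w \<longleftrightarrow> True"

lemma reduced_walk_imp_freely_reduced:
  "reduced_walk w \<Longrightarrow> freely_reduced (zip w (tl w))"
proof (induction w rule: reduced_walk.induct)
  case (1 x y w)
  then show ?case by (cases w) (auto simp: freely_reduced_def)
qed (auto simp: freely_reduced_def)

text \<open>The edges act from the last to the first, each being prepended without cancellation.
  Evaluating at the empty list thus recovers the walk, which is how nontriviality of a holonomy is
  detected.\<close>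

lemma holonomy_reduced_walk:
  "reduced_walk w \<Longrightarrow> Rep_bijection (holonomy w) [] = zip w (tl w)"
proof (induction w rule: reduced_walk.induct)
  case (1 x y w)
  have "Rep_bijection (holonomy (x # y # w)) [] = edge_act (x, y) (zip (y # w) w)"
    using 1 by (simp add: Rep_bijection_add gen.rep_eq)
  also have "\<dots> = (x, y) # zip (y # w) w"
    using 1 reduced_walk_imp_freely_reduced[of "y # w"]
    by (cases w) (auto simp: edge_act_def)
  finally show ?case by simp
qed (auto simp: zero_bijection.rep_eq)

lemma not_reduced_walkE:
  assumes "\<not> reduced_walk w"
  obtains u x v where "w = u @ x # x # v" | u x y v where "w = u @ x # y # x # v"
  using assms
proof (induction w arbitrary: thesis rule: reduced_walk.induct)
  case (1 x y w)
  show ?case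
  proof (cases "x = y \<or> (w \<noteq> [] \<and> x = hd w)")
    case True
    then show ?thesis
      using "1.prems"(1)[of "[]" x w] "1.prems"(2)[of "[]" x y "tl w"] by (cases w) auto
  next
    case False
    with 1 have *: "\<not> reduced_walk (y # w)" by auto
    show ?thesis
    proof (rule "1.IH")
      show "\<not> reduced_walk (y # w)" by fact
    next
      fix u z v assume "y # w = u @ z # z # v"
      then show ?thesis using "1.prems"(1)[of "x # u" z v] by simp
    next
      fix u z z' v assume "y # w = u @ z # z' # z # v"
      then show ?thesis using "1.prems"(2)[of "x # u" z z' v] by simp
    qed
  qed
qed auto

section \<open>Holonomy of cyclic words and contractibility\<close>

text \<open>Replaces modular indices by a split at the deleted letter: \<open>q @ p\<close> is the
  remaining cyclic word read from just after the gap, so its two ends are the cyclic neighbours of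
  \<open>y\<close>.\<close>

lemma contracting_step_iff:
  "contracting_step w w' \<longleftrightarrow>
     (\<exists>p y q. w = p @ y # q \<and> w' = p @ q \<and> q @ p \<noteq> [] \<and>
        \<not> distinct [last (q @ p), y, hd (q @ p)])"
proof -
  have neighbours: "last (q @ p) = w ! ((i + length w - 1) mod length w)"
      "hd (q @ p) = w ! (Suc i mod length w)"
    if "w = p @ y # q" "i = length p" "q @ p \<noteq> []" for p y q i
  proof -
    show "last (q @ p) = w ! ((i + length w - 1) mod length w)"
    proof (cases "p = []")
      case True
      with that show ?thesis by (auto simp: last_conv_nth nth_append)
    next
      case False
      then have "i + length w - 1 = (i - 1) + length w" "i - 1 < length w"
        using that by (cases i; auto)+
      then have "w ! ((i + length w - 1) mod length w) = w ! (i - 1)"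
        by (simp only: mod_add_self2 mod_less)
      moreover have "last (q @ p) = w ! (i - 1)"
        using that False by (cases p rule: rev_cases) (auto simp: nth_append)
      ultimately show ?thesis by (simp only:)
    qed
    show "hd (q @ p) = w ! (Suc i mod length w)"
    proof (cases "q = []")
      case True
      with that show ?thesis by (auto simp: hd_conv_nth nth_append)
    next
      case False
      with that show ?thesis by (auto simp: hd_conv_nth nth_append)
    qed
  qed
  show ?thesis
  proof
    assume "contracting_step w w'"
    then show "\<exists>p y q. w = p @ y # q \<and> w' = p @ q \<and> q @ p \<noteq> [] \<and>
        \<not> distinct [last (q @ p), y, hd (q @ p)]"
    proof cases
      case (1 i)
      let ?p = "take i w" and ?q = "drop (Suc i) w"
      have w: "w = ?p @ w ! i # ?q" using 1 by (simp add: id_take_nth_drop)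
      have ne: "?q @ ?p \<noteq> []" using 1 by auto
      show ?thesis
        using neighbours[OF w _ ne, of i] w ne 1 by (intro exI[of _ ?p] exI[of _ "w ! i"] exI[of _ ?q]) auto
    qed
  next
    assume "\<exists>p y q. w = p @ y # q \<and> w' = p @ q \<and> q @ p \<noteq> [] \<and>
        \<not> distinct [last (q @ p), y, hd (q @ p)]"
    then obtain p y q where *: "w = p @ y # q" "w' = p @ q" "q @ p \<noteq> []"
      "\<not> distinct [last (q @ p), y, hd (q @ p)]" by blast
    have "w' = take (length p) w @ drop (Suc (length p)) w" "w ! length p = y"
      using * by auto
    moreover have "2 \<le> length w" using * by (cases p; cases q) auto
    ultimately show "contracting_step w w'"
      using contracting_step.intros[of w "length p"] neighbours[OF *(1) refl *(3)] * by simp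
  qed
qed

definition cyclic_holonomy :: "'a list \<Rightarrow> ('a \<times> 'a) list bijection" where
  "cyclic_holonomy w = holonomy (w @ [hd w])"

lemma cyclic_holonomy_conv: "w \<noteq> [] \<Longrightarrow> cyclic_holonomy w = holonomy w + gen (last w) (hd w)"
  by (simp add: cyclic_holonomy_def holonomy_append)

lemma add_eq_0_commute: "(x :: 'g :: group_add) + y = 0 \<longleftrightarrow> y + x = 0"
  by (metis add_eq_0_iff neg_eq_iff_add_eq_0 add.inverse_inverse)

text \<open>Moving the base point conjugates the holonomy, from \<open>g + k\<close> to
  \<open>k + g\<close>. Its value therefore depends on the representative of the cyclic word, but
  its vanishing does not.\<close>

lemma cyclic_holonomy_rotate:
  assumes "u \<noteq> []" "v \<noteq> []"
  shows "cyclic_holonomy (u @ v) = 0 \<longleftrightarrow> cyclic_holonomy (v @ u) = 0"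
proof -
  have "cyclic_holonomy (u @ v) = (holonomy u + gen (last u) (hd v)) + (holonomy v + gen (last v) (hd u))"
       "cyclic_holonomy (v @ u) = (holonomy v + gen (last v) (hd u)) + (holonomy u + gen (last u) (hd v))"
    using assms by (simp_all add: cyclic_holonomy_conv holonomy_append add.assoc)
  then show ?thesis by (simp only: add_eq_0_commute)
qed

text \<open>With the deleted letter rotated to the end, only the two edges at it are affected, and
  \<open>gen_add\<close> merges them into the edge between its neighbours.\<close>

lemma contracting_step_holonomy:
  assumes "contracting_step w w'"
  shows "cyclic_holonomy w = 0 \<longleftrightarrow> cyclic_holonomy w' = 0"
proof -
  obtain p y q where w: "w = p @ y # q" "w' = p @ q" and ne: "q @ p \<noteq> []"
    and step: "\<not> distinct [last (q @ p), y, hd (q @ p)]"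
    using assms unfolding contracting_step_iff by blast
  let ?s = "q @ p"
  have "cyclic_holonomy w = 0 \<longleftrightarrow> cyclic_holonomy (?s @ [y]) = 0"
    using cyclic_holonomy_rotate[of p "y # q"] cyclic_holonomy_rotate[of "[y]" "q @ p"] ne w
    by (cases "p = []") auto
  also have "cyclic_holonomy (?s @ [y]) = cyclic_holonomy ?s"
  proof -
    have "cyclic_holonomy (s @ [y]) = cyclic_holonomy s"
      if "s \<noteq> []" "\<not> distinct [last s, y, hd s]" for s
      using that gen_add[OF that(2)]
      by (simp add: cyclic_holonomy_conv holonomy_append add.assoc del: distinct.simps)
    then show ?thesis using ne step by blast
  qed
  also have "cyclic_holonomy ?s = 0 \<longleftrightarrow> cyclic_holonomy w' = 0"
    using cyclic_holonomy_rotate[of p q] w by (cases "p = [] \<or> q = []") auto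
  finally show ?thesis .
qed

lemma contracting_step_length: "contracting_step w w' \<Longrightarrow> length w = Suc (length w')"
  unfolding contracting_step_iff by auto

text \<open>For the converse, a closed walk with trivial holonomy and at least one edge is not
  reduced, and any repetition or backtrack in it permits a contracting step. The step preserves
  trivial holonomy, so contraction can proceed greedily and never gets stuck.\<close>

theorem contractible_iff_cyclic_holonomy:
  assumes "w \<noteq> []"
  shows "contractible_word w \<longleftrightarrow> cyclic_holonomy w = 0"
proof
  assume "contractible_word w"
  then obtain x where "contracting_step\<^sup>*\<^sup>* w [x]" by (auto simp: contractible_word_def)
  then show "cyclic_holonomy w = 0"
    by (induction rule: converse_rtranclp_induct)
      (simp_all add: contracting_step_holonomy, simp add: cyclic_holonomy_def)
next
  assume "cyclic_holonomy w = 0"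
  with assms show "contractible_word w"
  proof (induction "length w" arbitrary: w rule: less_induct)
    case less
    show ?case
    proof (cases "length w = 1")
      case True
      then show ?thesis by (auto simp: contractible_word_def length_Suc_conv)
    next
      case False
      have "\<not> reduced_walk (w @ [hd w])"
      proof
        assume "reduced_walk (w @ [hd w])"
        from holonomy_reduced_walk[OF this] less.prems have "zip (w @ [hd w]) (tl (w @ [hd w])) = []"
          by (simp add: cyclic_holonomy_def zero_bijection.rep_eq)
        then show False using less.prems(1) by (cases w) auto
      qed
      then have "\<exists>w'. contracting_step w w'"
      proof (cases rule: not_reduced_walkE)
        case (1 u x v)
        show ?thesis
        proof (cases v rule: rev_cases)
          \<comment> \<open>With \<open>v\<close> empty, the repetition involves the closing copy of
            the first letter, so it sits at the seam of the cyclic word and the last letter is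
            deleted.\<close>
          case Nil
          with 1 have "w = u @ [x]" "hd w = x" by auto
          then show ?thesis
            using False less.prems
            by (intro exI[of _ u], unfold contracting_step_iff)
              (rule exI[of _ u], rule exI[of _ x], rule exI[of _ "[]"], cases u, auto)
        next
          case (snoc v' z)
          with 1 have "w = u @ x # x # v'" by auto
          then show ?thesis
            by (intro exI[of _ "u @ x # v'"], unfold contracting_step_iff)
              (rule exI[of _ u], rule exI[of _ x], rule exI[of _ "x # v'"], auto)
        qed
      next
        case (2 u x y v)
        show ?thesis
        proof (cases v rule: rev_cases)
          case Nil
          with 2 have "w = u @ [x, y]" "hd w = x" by auto
          then show ?thesis
            by (intro exI[of _ "u @ [x]"], unfold contracting_step_iff)
              (rule exI[of _ "u @ [x]"], rule exI[of _ y], rule exI[of _ "[]"], cases u, auto)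
        next
          case (snoc v' z)
          with 2 have "w = u @ x # y # x # v'" by auto
          then show ?thesis
            by (intro exI[of _ "u @ x # x # v'"], unfold contracting_step_iff)
              (rule exI[of _ "u @ [x]"], rule exI[of _ y], rule exI[of _ "x # v'"], auto)
        qed
      qed
      then obtain w' where w': "contracting_step w w'" by blast
      then have "length w' < length w" "w' \<noteq> []"
        using contracting_step_length[OF w'] False by auto
      moreover have "cyclic_holonomy w' = 0"
        using contracting_step_holonomy[OF w'] less.prems by simp
      ultimately have "contractible_word w'" using less.hyps by blast
      with w' show ?thesis
        by (auto simp: contractible_word_def intro: converse_rtranclp_into_rtranclp)
    qed
  qed
qed

section \<open>The stack algorithm\<close>

text \<open>The stack, read from bottom to top, is the reduced form of the walk spelled so far;
  popping undoes a backtrack.\<close>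

fun move :: "'a \<Rightarrow> 'a list \<Rightarrow> 'a list" where
  "move y (x # s) =
     (if y = x then x # s else if s \<noteq> [] \<and> hd s = y then s else y # x # s)"
| "move y [] = [y]"

definition run_stack :: "'a list \<Rightarrow> 'a list" where
  "run_stack w = fold move (tl w) [hd w]"

lemma reduced_walk_append:
  "reduced_walk (u @ [x, y]) \<longleftrightarrow> reduced_walk (u @ [x]) \<and> x \<noteq> y \<and> (u \<noteq> [] \<longrightarrow> last u \<noteq> y)"
  by (induction u rule: reduced_walk.induct) auto

lemma reduced_walk_butlast: "reduced_walk (u @ [x]) \<Longrightarrow> reduced_walk u"
  by (induction u rule: reduced_walk.induct) (auto split: if_splits simp: hd_append)

lemma move_invariant:
  assumes "s \<noteq> []" "reduced_walk (rev s)" "last s = a"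
  shows "move y s \<noteq> []" "reduced_walk (rev (move y s))" "last (move y s) = a" "hd (move y s) = y"
    "holonomy (rev (move y s)) = holonomy (rev s) + gen (hd s) y"
proof -
  obtain x s' where s: "s = x # s'" using assms(1) by (cases s) auto
  have "move y s \<noteq> [] \<and> reduced_walk (rev (move y s)) \<and> last (move y s) = a \<and> hd (move y s) = y \<and>
    holonomy (rev (move y s)) = holonomy (rev s) + gen (hd s) y"
  proof (cases "y = x \<or> s' = []")
    case True
    then show ?thesis using assms s by auto
  next
    case False
    then obtain z s'' where s': "s' = z # s''" by (cases s') auto
    show ?thesis
      using assms s s' False reduced_walk_append[of "rev s''" z x] reduced_walk_butlast
        reduced_walk_append[of "rev s'" x y] holonomy_append[of "rev s'" "[x]"]
        holonomy_append[of "rev s' @ [x]" "[y]"]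
      by (auto simp: last_rev hd_rev add.assoc split: if_splits)
  qed
  then show "move y s \<noteq> []" "reduced_walk (rev (move y s))" "last (move y s) = a" "hd (move y s) = y"
    "holonomy (rev (move y s)) = holonomy (rev s) + gen (hd s) y" by auto
qed

lemma fold_move_invariant:
  assumes "s \<noteq> []" "reduced_walk (rev s)" "last s = a"
  shows "fold move w s \<noteq> [] \<and> reduced_walk (rev (fold move w s)) \<and> last (fold move w s) = a \<and>
    hd (fold move w s) = last (hd s # w) \<and>
    holonomy (rev (fold move w s)) = holonomy (rev s) + holonomy (hd s # w)"
  using assms
proof (induction w arbitrary: s)
  case (Cons y w)
  note inv = move_invariant[OF Cons.prems, of y]
  show ?case using Cons.IH[OF inv(1-3)] inv by (simp add: add.assoc)
qed auto

text \<open>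
  The cyclic word need not be closed up explicitly: if closing the reduced walk on the stack makes
  it null-homotopic, then it has at most one letter after the starting letter.
\<close>

theorem contractible_iff_run_stack:
  assumes "w \<noteq> []"
  shows "contractible_word w \<longleftrightarrow> length (run_stack w) \<le> 2"
proof -
  let ?s = "run_stack w"
  obtain a w' where w: "w = a # w'" using assms by (cases w) auto
  have inv: "?s \<noteq> []" "reduced_walk (rev ?s)" "last ?s = a" "hd ?s = last w" "holonomy (rev ?s) = holonomy w"
    using fold_move_invariant[of "[a]" a w'] w by (auto simp: run_stack_def)
  have hol: "cyclic_holonomy w = holonomy (rev ?s) + gen (hd ?s) a"
    using inv assms w by (simp add: cyclic_holonomy_conv)
  show ?thesis
  proof (cases "length ?s \<le> 2")
    case True
    then consider b where "?s = [b]" | b c where "?s = [b, c]"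
      using inv(1) by (cases ?s; cases "tl ?s"; cases "tl (tl ?s)") auto
    then have "cyclic_holonomy w = 0"
      using hol inv by cases (simp_all flip: inv(5))
    with True show ?thesis using contractible_iff_cyclic_holonomy[OF assms] by simp
  next
    case False
    have "cyclic_holonomy w \<noteq> 0"
    proof
      assume "cyclic_holonomy w = 0"
      then have "holonomy (rev ?s) = gen a (hd ?s)"
        using hol by (simp add: add_eq_0_iff2 gen_swap eq_neg_iff_add_eq_0)
      \<comment> \<open>A single generator sends the empty list to at most one edge, whereas the
        reduced walk on a stack of three or more letters has at least two.\<close>
      then have "zip (rev ?s) (tl (rev ?s)) = edge_act (a, hd ?s) []"
        using holonomy_reduced_walk[OF inv(2)] by (simp add: gen.rep_eq)
      then have "length (zip (rev ?s) (tl (rev ?s))) \<le> 1" by (simp only:) (simp add: edge_act_def)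
      then have "length ?s - 1 \<le> 1" by simp
      then show False using False by linarith
    qed
    with False show ?thesis using contractible_iff_cyclic_holonomy[OF assms] by simp
  qed
qed

section \<open>Implementation on the machine\<close>

text \<open>Layout by address: 0-2 push the first color; 3 is the loop test; 4-7 read a color and
  compare it with the top; 8-12 compare it with the entry below the top, if there is one; 13-15
  push; 16-17 pop; 18-22 accept iff the top has address 0 or 1, that is, iff at most two letters
  remain. \<open>JumpEq 6 6\<close> is an unconditional jump.\<close>

definition stack_program :: "instr list" where
  "stack_program =
    [ReadColor 3 1, Store 2 3, Inc 1,
     JumpEq 1 0 18,
     ReadColor 3 1, Inc 1, Load 4 2, JumpEq 3 4 3,
     JumpEq 2 6 13, Move 5 2, Dec 5, Load 4 5, JumpEq 3 4 16,
     Inc 2, Store 2 3, JumpEq 6 6 3,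
     Dec 2, JumpEq 6 6 3,
     JumpEq 2 6 22, Dec 2, JumpEq 2 6 22, Reject,
     Accept]"

lemma color_code_inject [simp]: "color_code x = color_code y \<longleftrightarrow> x = y"
  by (cases x; cases y) auto

text \<open>
  The stack is stored bottom first from address 0, and register 2 is the address of its top;
  register 1 counts the letters read, and register 6 stays 0.
\<close>

definition represents ::
  "nat \<Rightarrow> nat \<Rightarrow> color list \<Rightarrow> (nat \<Rightarrow> nat) \<Rightarrow> (nat \<Rightarrow> nat) \<Rightarrow> bool" where
  "represents n i s R M \<longleftrightarrow>
     R 0 = n \<and> R 1 = i \<and> R 6 = 0 \<and> s \<noteq> [] \<and> R 2 = length s - 1 \<and>
     (\<forall>j < length s. M j = color_code (rev s ! j))"

lemma represents_top:
  "represents n i (x # s) R M \<Longrightarrow> M (R 2) = color_code x"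
  by (auto simp: represents_def nth_append)

abbreviation run :: "(int \<times> int) list \<Rightarrow> nat \<Rightarrow> config \<Rightarrow> config" where
  "run vs k c \<equiv> (step stack_program vs ^^ k) c"

lemma run_add: "run vs (k + l) c = run vs k (run vs l c)"
  by (simp add: funpow_add)

text \<open>The numbers of steps are the lengths of the four paths through the loop: 5 if the letter
  equals the top, 12 for a pop, 9 for a push onto a single letter, and 13 for any other
  push.\<close>

lemma stack_program_iteration:
  assumes rep: "represents (length vs) i s R M" and i: "i < length vs"
  shows "\<exists>k R' M'. k \<le> 13 \<and> run vs k (Running 3 R M) = Running 3 R' M' \<and>
    represents (length vs) (Suc i) (move (color_of (vs ! i)) s) R' M'"
proof -
  let ?y = "color_of (vs ! i)"
  obtain x s' where s: "s = x # s'" using rep by (cases s) (auto simp: represents_def)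
  note top = represents_top[OF rep[unfolded s]]
  note exec = stack_program_def numeral_eq_Suc
  have R: "R 0 = length vs" "R (Suc 0) = i" "R 6 = 0" "R 2 = length s'"
    using rep by (auto simp: represents_def s)
  have M: "M j = color_code ((rev s' @ [x]) ! j)" if "j \<le> length s'" for j
    using rep that by (auto simp: represents_def s)
  consider "?y = x" | z s'' where "?y \<noteq> x" "s' = z # s''" "z = ?y"
    | "?y \<noteq> x" "s' = []" | z s'' where "?y \<noteq> x" "s' = z # s''" "z \<noteq> ?y"
    by (cases s') auto
  then show ?thesis
  proof cases
    case 1
    show ?thesis
      by (intro exI[of _ 5] exI) (use 1 R M i top in \<open>auto simp: exec represents_def s\<close>)
  next
    case 2
    have "M (length s'') = color_code z"
      using M[of "length s''"] 2 by (simp add: nth_append)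
    then show ?thesis
      by (intro exI[of _ 12] exI)
        (use 2 R M i top in \<open>auto simp: exec represents_def s nth_append\<close>)
  next
    case 3
    show ?thesis
      by (intro exI[of _ 9] exI)
        (use 3 R M i top in \<open>auto simp: exec represents_def s nth_append less_Suc_eq\<close>)
  next
    case 4
    have "M (length s'') = color_code z"
      using M[of "length s''"] 4 by (simp add: nth_append)
    then show ?thesis
      by (intro exI[of _ 13] exI)
        (use 4 R M i top in \<open>auto simp: exec represents_def s nth_append less_Suc_eq\<close>)
  qed
qed

lemma stack_program_loop:
  assumes "represents (length vs) i s R M" "i \<le> length vs"
  shows "\<exists>k R' M'. k \<le> 13 * (length vs - i) \<and> run vs k (Running 3 R M) = Running 3 R' M' \<and>
    represents (length vs) (length vs) (fold move (map color_of (drop i vs)) s) R' M'"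
  using assms
proof (induction "length vs - i" arbitrary: i s R M)
  case 0
  then show ?case by (intro exI[of _ 0] exI[of _ R] exI[of _ M]) auto
next
  case (Suc d)
  then have i: "i < length vs" by simp
  from stack_program_iteration[OF Suc.prems(1) i] obtain k R1 M1 where
    1: "k \<le> 13" "run vs k (Running 3 R M) = Running 3 R1 M1"
      "represents (length vs) (Suc i) (move (color_of (vs ! i)) s) R1 M1" by blast
  from Suc.hyps(1)[OF _ 1(3)] Suc.hyps(2) i obtain l R2 M2 where
    2: "l \<le> 13 * (length vs - Suc i)" "run vs l (Running 3 R1 M1) = Running 3 R2 M2"
      "represents (length vs) (length vs)
        (fold move (map color_of (drop (Suc i) vs)) (move (color_of (vs ! i)) s)) R2 M2"
    by fastforce
  show ?case
  proof (intro exI conjI)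
    show "run vs (l + k) (Running 3 R M) = Running 3 R2 M2"
      by (simp only: run_add 1 2)
    show "l + k \<le> 13 * (length vs - i)" using 1(1) 2(1) i by linarith
    show "represents (length vs) (length vs) (fold move (map color_of (drop i vs)) s) R2 M2"
      using 2(3) i by (simp flip: Cons_nth_drop_Suc)
  qed
qed

lemma run_Halted: "run vs k (Halted b) = Halted b"
  by (induction k) auto

lemma stack_program_correct:
  assumes "vs \<noteq> []"
  shows "halts_within stack_program vs (13 * length vs)
    (length (run_stack (boundary_word vs)) \<le> 2)"
proof -
  let ?s = "run_stack (boundary_word vs)"
  note exec = stack_program_def numeral_eq_Suc
  obtain R M where 0: "run vs 3 (initial_config vs) = Running 3 R M"
    "represents (length vs) 1 [color_of (vs ! 0)] R M"
    using assms by (auto simp: initial_config_def exec represents_def)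
  have "fold move (map color_of (drop 1 vs)) [color_of (vs ! 0)] = ?s"
    using assms by (cases vs) (auto simp: run_stack_def boundary_word_def)
  with stack_program_loop[OF 0(2)] assms obtain k R1 M1 where
    1: "k \<le> 13 * (length vs - 1)" "run vs k (Running 3 R M) = Running 3 R1 M1"
      "represents (length vs) (length vs) ?s R1 M1"
    by (cases vs) fastforce+
  have 2: "run vs 5 (Running 3 R1 M1) = Halted (length ?s \<le> 2)"
    using 1(3) assms by (cases ?s; cases "tl ?s") (auto simp: exec represents_def)
  \<comment> \<open>Setup takes 3 steps and the final test at most 5. The first letter is handled by
    the setup and needs no loop iteration, so its share of 13 steps pays for both; a halted machine
    stays halted for the remaining time.\<close>
  have "k + 8 \<le> 13 * length vs" using 1(1) assms by (cases vs) auto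
  then have "13 * length vs = (13 * length vs - (k + 8)) + (5 + (k + 3))" by simp
  then have "run vs (13 * length vs) (initial_config vs) =
    run vs (13 * length vs - (k + 8)) (run vs 5 (run vs k (run vs 3 (initial_config vs))))"
    by (metis run_add)
  then show ?thesis by (simp only: halts_within_def 0 1 2 run_Halted)
qed

section \<open>Potentials on convex sets\<close>

text \<open>The pieces on which \<open>f\<close> takes the value \<open>f x\<close> and the other
  pieces have closed unions that are disjoint on \<open>K\<close>, so connectedness forces one side
  to be empty. The values form a bare set, which is why closed covers replace continuity.\<close>

lemma locally_constant_on_finite_closed_cover:
  fixes f :: "'a::topological_space \<Rightarrow> 'b"
  assumes "connected K" "finite \<T>" "K \<subseteq> \<Union>\<T>" "\<And>T. T \<in> \<T> \<Longrightarrow> closed T"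
    and const: "\<And>T x y. T \<in> \<T> \<Longrightarrow> x \<in> K \<inter> T \<Longrightarrow> y \<in> K \<inter> T \<Longrightarrow> f x = f y"
    and "x \<in> K" "y \<in> K"
  shows "f x = f y"
proof (rule ccontr)
  assume neq: "f x \<noteq> f y"
  define \<U> where "\<U> = {T \<in> \<T>. \<exists>z \<in> K \<inter> T. f z = f x}"
  have cl: "closed (\<Union>\<U>)" "closed (\<Union>(\<T> - \<U>))"
    using assms(2,4) by (auto simp: \<U>_def intro!: closed_Union)
  have "\<Union>\<U> \<inter> \<Union>(\<T> - \<U>) \<inter> K = {}"
  proof (rule ccontr)
    assume "\<Union>\<U> \<inter> \<Union>(\<T> - \<U>) \<inter> K \<noteq> {}"
    then obtain z S T where z: "z \<in> K" "z \<in> S" "z \<in> T" "S \<in> \<U>" "T \<in> \<T> - \<U>" by blast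
    then obtain z' where "z' \<in> K \<inter> S" "f z' = f x" by (auto simp: \<U>_def)
    with const[of S z z'] z have "f z = f x" by (auto simp: \<U>_def)
    with z show False by (auto simp: \<U>_def)
  qed
  moreover have "K \<subseteq> \<Union>\<U> \<union> \<Union>(\<T> - \<U>)" using assms(3) by blast
  moreover have "\<Union>\<U> \<inter> K \<noteq> {}"
    using assms(3,6) by (auto simp: \<U>_def)
  moreover have "\<Union>(\<T> - \<U>) \<inter> K \<noteq> {}"
  proof -
    obtain T where T: "T \<in> \<T>" "y \<in> T" using assms(3,7) by blast
    have "T \<notin> \<U>"
    proof
      assume "T \<in> \<U>"
      then obtain z where "z \<in> K \<inter> T" "f z = f x" by (auto simp: \<U>_def)
      with const[of T z y] T assms(7) neq show False by auto
    qed
    with T assms(7) show ?thesis by blast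
  qed
  ultimately show False
    using assms(1) cl unfolding connected_closed by blast
qed

text \<open>A line is represented by \<open>(a, b)\<close>, standing for \<open>{x. a \<bullet> x = b}\<close>.\<close>

definition cuts :: "'a::real_inner \<times> real \<Rightarrow> 'a set \<Rightarrow> bool" where
  "cuts l R \<longleftrightarrow> (\<exists>x\<in>R. fst l \<bullet> x < snd l) \<and> (\<exists>x\<in>R. fst l \<bullet> x > snd l)"

lemma cuts_mono: "cuts l R \<Longrightarrow> R \<subseteq> R' \<Longrightarrow> cuts l R'"
  by (auto simp: cuts_def)

text \<open>The average of points off the pieces' separating lines lies in no piece.\<close>

lemma uncut_convex_subset_piece:
  fixes R :: "'a::euclidean_space set"
  assumes "convex R" "R \<noteq> {}" "finite \<T>" "R \<subseteq> \<Union>\<T>"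
    and pieces: "\<And>T. T \<in> \<T> \<Longrightarrow> \<exists>\<H>. T = {x. \<forall>l\<in>\<H>. fst l \<bullet> x \<le> snd l} \<and> (\<forall>l\<in>\<H>. \<not> cuts l R)"
  shows "\<exists>T\<in>\<T>. R \<subseteq> T"
proof (rule ccontr)
  assume none: "\<not> (\<exists>T\<in>\<T>. R \<subseteq> T)"
  have "\<exists>l z. T \<subseteq> {x. fst l \<bullet> x \<le> snd l} \<and> R \<subseteq> {x. fst l \<bullet> x \<ge> snd l} \<and> z \<in> R \<and> fst l \<bullet> z > snd l"
    if T: "T \<in> \<T>" for T
  proof -
    obtain \<H> where \<H>: "T = {x. \<forall>l\<in>\<H>. fst l \<bullet> x \<le> snd l}" "\<forall>l\<in>\<H>. \<not> cuts l R"
      using pieces[OF T] by blast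
    obtain z where "z \<in> R" "z \<notin> T" using none T by blast
    moreover from this(2) obtain l where l: "l \<in> \<H>" "fst l \<bullet> z > snd l"
      by (subst (asm) \<H>(1)) (auto simp: not_le)
    moreover have "T \<subseteq> {x. fst l \<bullet> x \<le> snd l}" by (subst \<H>(1)) (use l in blast)
    moreover have "R \<subseteq> {x. fst l \<bullet> x \<ge> snd l}"
    proof
      fix x assume "x \<in> R"
      moreover have "\<not> cuts l R" using l(1) \<H>(2) by blast
      ultimately show "x \<in> {x. fst l \<bullet> x \<ge> snd l}"
        using \<open>z \<in> R\<close> l(2) by (auto simp: cuts_def not_less)
    qed
    ultimately show ?thesis by blast
  qed
  then obtain l z where lz: "\<And>T. T \<in> \<T> \<Longrightarrow> T \<subseteq> {x. fst (l T) \<bullet> x \<le> snd (l T)}"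
    "\<And>T. T \<in> \<T> \<Longrightarrow> R \<subseteq> {x. fst (l T) \<bullet> x \<ge> snd (l T)}"
    "\<And>T. T \<in> \<T> \<Longrightarrow> z T \<in> R" "\<And>T. T \<in> \<T> \<Longrightarrow> fst (l T) \<bullet> z T > snd (l T)"
    by metis
  have "\<T> \<noteq> {}" using assms by auto
  define w where "w = (\<Sum>T\<in>\<T>. (1 / card \<T>) *\<^sub>R z T)"
  have "w \<in> R"
    unfolding w_def using assms lz(3) \<open>\<T> \<noteq> {}\<close> by (intro convex_sum) auto
  then obtain T where T: "T \<in> \<T>" "w \<in> T" using assms(4) by blast
  have "fst (l T) \<bullet> w = (\<Sum>S\<in>\<T>. (1 / card \<T>) * (fst (l T) \<bullet> z S))"
    by (simp add: w_def inner_sum_right)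
  also have "\<dots> > (\<Sum>S\<in>\<T>. (1 / card \<T>) * snd (l T))"
  proof (rule sum_strict_mono_ex1)
    show "\<forall>S\<in>\<T>. 1 / card \<T> * snd (l T) \<le> 1 / card \<T> * (fst (l T) \<bullet> z S)"
      using lz(2)[OF T(1)] lz(3) by (intro ballI mult_left_mono) auto
    show "\<exists>S\<in>\<T>. 1 / card \<T> * snd (l T) < 1 / card \<T> * (fst (l T) \<bullet> z S)"
      using lz(4)[OF T(1)] T(1) assms(3) \<open>\<T> \<noteq> {}\<close>
      by (intro bexI[of _ T] mult_strict_left_mono) (auto simp: card_gt_0_iff)
  qed (use assms in auto)
  finally show False using lz(1)[OF T(1)] T(2) assms(3) \<open>\<T> \<noteq> {}\<close> by (auto simp: field_simps)
qed

text \<open>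
  A Poincare lemma: local potentials that differ by constants on overlaps combine into a global
  one. \<open>R\<close> is cut along the lines bounding the pieces until it lies within one piece; potentials
  on the two sides of a cut differ by a constant because the cut is connected.
\<close>

lemma global_potential_aux:
  fixes R :: "'a::euclidean_space set" and h :: "'a set \<Rightarrow> 'a \<Rightarrow> 'g::group_add"
  assumes "finite \<T>"
    and halfspaces: "\<And>T x. T \<in> \<T> \<Longrightarrow> x \<in> T \<longleftrightarrow> (\<forall>l\<in>\<H> T. fst l \<bullet> x \<le> snd l)"
    and consistent: "\<And>S T x y. S \<in> \<T> \<Longrightarrow> T \<in> \<T> \<Longrightarrow> x \<in> S \<inter> T \<Longrightarrow> y \<in> S \<inter> T \<Longrightarrow>
           - h S x + h S y = - h T x + h T y"
    and "finite \<L>" "convex R" "R \<subseteq> \<Union>\<T>" "\<And>T l. T \<in> \<T> \<Longrightarrow> l \<in> \<H> T \<Longrightarrow> cuts l R \<Longrightarrow> l \<in> \<L>"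
  shows "\<exists>H. \<forall>T\<in>\<T>. \<exists>c. \<forall>x\<in>R \<inter> T. H x = c + h T x"
  using assms(4-)
proof (induction \<L> arbitrary: R rule: finite_induct)
  case empty
  show ?case
  proof (cases "R = {}")
    case False
    have "\<exists>T\<in>\<T>. R \<subseteq> T"
    proof (rule uncut_convex_subset_piece)
      fix T assume T: "T \<in> \<T>"
      show "\<exists>\<H>. T = {x. \<forall>l\<in>\<H>. fst l \<bullet> x \<le> snd l} \<and> (\<forall>l\<in>\<H>. \<not> cuts l R)"
        by (rule exI[of _ "\<H> T"]) (use halfspaces[OF T] empty(3)[OF T] in auto)
    qed (use empty False assms(1) in auto)
    then obtain S where S: "S \<in> \<T>" "R \<subseteq> S" by blast
    show ?thesis
    proof (intro exI[of _ "h S"] ballI)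
      fix T assume T: "T \<in> \<T>"
      show "\<exists>c. \<forall>x\<in>R \<inter> T. h S x = c + h T x"
      proof (cases "R \<inter> T = {}")
        case False
        then obtain z where z: "z \<in> R \<inter> T" by blast
        have "h S x = (h S z - h T z) + h T x" if "x \<in> R \<inter> T" for x
        proof -
          have "h S x = h S z + (- h S z + h S x)" by (simp add: add.assoc[symmetric])
          also have "- h S z + h S x = - h T z + h T x"
            using consistent[OF S(1) T] z that S by auto
          finally show ?thesis by (simp add: add.assoc[symmetric])
        qed
        then show ?thesis by blast
      qed auto
    qed
  qed auto
next
  case (insert l \<L>)
  have closed: "closed T" "convex T" if "T \<in> \<T>" for T
  proof -
    have "T = (\<Inter>l\<in>\<H> T. {x. fst l \<bullet> x \<le> snd l})"
      using halfspaces[OF that] by (intro set_eqI) simp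
    moreover have "closed (\<Inter>l\<in>\<H> T. {x. fst l \<bullet> x \<le> snd l})"
      "convex (\<Inter>l\<in>\<H> T. {x. fst l \<bullet> x \<le> snd l})"
      by (auto intro!: closed_INT convex_INT closed_halfspace_le convex_halfspace_le)
    ultimately show "closed T" "convex T" by simp_all
  qed
  define R1 where "R1 = R \<inter> {x. fst l \<bullet> x \<le> snd l}"
  define R2 where "R2 = R \<inter> {x. fst l \<bullet> x \<ge> snd l}"
  \<comment> \<open>The line \<open>l\<close> cuts neither half, so the lines cutting a half all lie
    in the smaller set \<open>\<L>\<close> and the induction hypothesis applies to both
    halves.\<close>
  have "l' \<in> \<L>" if "T \<in> \<T>" "l' \<in> \<H> T" "cuts l' R' " "R' = R1 \<or> R' = R2" for l' T R'
  proof -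
    have "cuts l' R" using that(3,4) by (auto simp: R1_def R2_def intro: cuts_mono)
    then have "l' \<in> insert l \<L>" using insert.prems(3) that by blast
    moreover have "\<not> cuts l R'" using that(4) by (auto simp: cuts_def R1_def R2_def)
    ultimately show ?thesis using that(3) by auto
  qed
  then have "\<exists>H. \<forall>T\<in>\<T>. \<exists>c. \<forall>x\<in>R1 \<inter> T. H x = c + h T x"
    "\<exists>H. \<forall>T\<in>\<T>. \<exists>c. \<forall>x\<in>R2 \<inter> T. H x = c + h T x"
    using insert.prems(1,2)
    by (auto simp: R1_def R2_def convex_Int convex_halfspace_le convex_halfspace_ge intro!: insert.IH)
  then obtain H1 H2 where H1: "\<And>T. T \<in> \<T> \<Longrightarrow> \<exists>c. \<forall>x\<in>R1 \<inter> T. H1 x = c + h T x"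
    and H2: "\<And>T. T \<in> \<T> \<Longrightarrow> \<exists>c. \<forall>x\<in>R2 \<inter> T. H2 x = c + h T x" by blast
  define K where "K = R1 \<inter> R2"
  have "\<exists>g. \<forall>x\<in>K. H1 x = g + H2 x"
  proof (cases "K = {}")
    case False
    then obtain z where z: "z \<in> K" by blast
    have "H1 x - H2 x = H1 z - H2 z" if x: "x \<in> K" for x
    proof (rule locally_constant_on_finite_closed_cover[of K \<T> "\<lambda>x. H1 x - H2 x"])
      have "K = R \<inter> {x. fst l \<bullet> x = snd l}" by (auto simp: K_def R1_def R2_def)
      then show "connected K"
        using insert.prems(1) by (simp add: convex_connected convex_Int convex_hyperplane)
      show "K \<subseteq> \<Union>\<T>" using insert.prems(2) by (auto simp: K_def R1_def)
      fix T x y assume T: "T \<in> \<T>" and xy: "x \<in> K \<inter> T" "y \<in> K \<inter> T"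
      obtain c1 c2 where c: "\<forall>x\<in>R1 \<inter> T. H1 x = c1 + h T x" "\<forall>x\<in>R2 \<inter> T. H2 x = c2 + h T x"
        using H1[OF T] H2[OF T] by blast
      \<comment> \<open>The constants stand on the left, so \<open>h T x\<close> cancels in this
        difference even without commutativity.\<close>
      have "H1 x - H2 x = c1 - c2" if "x \<in> K \<inter> T" for x
        using c that by (simp add: K_def diff_conv_add_uminus minus_add add.assoc
            del: add_uminus_conv_diff)
      then show "H1 x - H2 x = H1 y - H2 y" using xy by simp
    qed (use assms(1) closed x z in auto)
    then have "H1 x = (H1 z - H2 z) + H2 x" if "x \<in> K" for x
      using that by (metis diff_add_cancel)
    then show ?thesis by blast
  qed auto
  then obtain g where g: "\<And>x. x \<in> K \<Longrightarrow> H1 x = g + H2 x" by blast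
  define H where "H x = (if x \<in> R1 then H1 x else g + H2 x)" for x
  have H_R2: "H x = g + H2 x" if "x \<in> R2" for x
    using that g by (auto simp: H_def K_def)
  have R: "R = R1 \<union> R2" by (auto simp: R1_def R2_def)
  have "\<exists>c. \<forall>x\<in>R \<inter> T. H x = c + h T x" if T: "T \<in> \<T>" for T
  proof -
    obtain c1 c2 where c: "\<And>x. x \<in> R1 \<inter> T \<Longrightarrow> H1 x = c1 + h T x" "\<And>x. x \<in> R2 \<inter> T \<Longrightarrow> H2 x = c2 + h T x"
      using H1[OF T] H2[OF T] by blast
    have 2: "H x = (g + c2) + h T x" if "x \<in> R2 \<inter> T" for x
      using H_R2[of x] c(2)[OF that] that by (simp add: add.assoc)
    have 1: "H x = c1 + h T x" if "x \<in> R1 \<inter> T" for x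
      using c(1)[OF that] that by (simp add: H_def)
    consider "R1 \<inter> T = {}" | "R2 \<inter> T = {}" | x y where "x \<in> R1 \<inter> T" "y \<in> R2 \<inter> T" by blast
    then show ?thesis
    proof cases
      case 3
      \<comment> \<open>A piece meeting both halves is convex, so it also meets the cut; comparing
        the two descriptions of \<open>H\<close> there shows that the constants agree.\<close>
      have "\<exists>z \<in> closed_segment x y. fst l \<bullet> z = snd l"
        using 3 connected_ivt_hyperplane[of "closed_segment x y" x y "fst l" "snd l"]
        by (auto simp: R1_def R2_def)
      then obtain z where z: "z \<in> closed_segment x y" "fst l \<bullet> z = snd l" by blast
      have "z \<in> R \<inter> T"
        using 3 z(1) insert.prems(1) closed(2)[OF T]
        by (intro IntI) (auto simp: R1_def R2_def dest: closed_segment_subset)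
      then have "z \<in> R1 \<inter> T" "z \<in> R2 \<inter> T" using z by (auto simp: R1_def R2_def)
      then have "c1 = g + c2" using 1[of z] 2[of z] by (metis add_right_cancel)
      then show ?thesis using 1 2 R by (intro exI[of _ c1]) auto
    qed (use 1 2 R in blast)+
  qed
  then show ?case by blast
qed

lemma global_potential:
  fixes h :: "'a::euclidean_space set \<Rightarrow> 'a \<Rightarrow> 'g::group_add"
  assumes "convex P" "finite \<T>" "P \<subseteq> \<Union>\<T>" "\<And>T. T \<in> \<T> \<Longrightarrow> polyhedron T"
    and "\<And>S T x y. S \<in> \<T> \<Longrightarrow> T \<in> \<T> \<Longrightarrow> x \<in> S \<inter> T \<Longrightarrow> y \<in> S \<inter> T \<Longrightarrow>
           - h S x + h S y = - h T x + h T y"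
  obtains H where "\<And>T. T \<in> \<T> \<Longrightarrow> \<exists>c. \<forall>x\<in>P \<inter> T. H x = c + h T x"
proof -
  have "\<forall>T\<in>\<T>. \<exists>\<H>. finite \<H> \<and> (\<forall>x. x \<in> T \<longleftrightarrow> (\<forall>l\<in>\<H>. fst l \<bullet> x \<le> snd l))"
  proof
    fix T assume T: "T \<in> \<T>"
    obtain F where F: "finite F" "T = \<Inter>F" "\<forall>k\<in>F. \<exists>a b. a \<noteq> 0 \<and> k = {x. a \<bullet> x \<le> b}"
      using assms(4)[OF T] unfolding polyhedron_def by blast
    have "\<forall>k\<in>F. \<exists>l. \<forall>x. x \<in> k \<longleftrightarrow> fst l \<bullet> x \<le> snd l"
    proof
      fix k assume "k \<in> F"
      then obtain a b where "k = {x. a \<bullet> x \<le> b}" using F(3) by blast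
      then show "\<exists>l. \<forall>x. x \<in> k \<longleftrightarrow> fst l \<bullet> x \<le> snd l" by (intro exI[of _ "(a, b)"]) simp
    qed
    from bchoice[OF this] obtain l
      where l: "\<And>k x. k \<in> F \<Longrightarrow> x \<in> k \<longleftrightarrow> fst (l k) \<bullet> x \<le> snd (l k)" by blast
    have "x \<in> T \<longleftrightarrow> (\<forall>k\<in>F. fst (l k) \<bullet> x \<le> snd (l k))" for x
      unfolding F(2) Inter_iff using l by simp
    with F(1) show "\<exists>\<H>. finite \<H> \<and> (\<forall>x. x \<in> T \<longleftrightarrow> (\<forall>l\<in>\<H>. fst l \<bullet> x \<le> snd l))"
      by (intro exI[of _ "l ` F"]) auto
  qed
  from bchoice[OF this] obtain \<H> where \<H>: "\<And>T. T \<in> \<T> \<Longrightarrow> finite (\<H> T)"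
    "\<And>T x. T \<in> \<T> \<Longrightarrow> x \<in> T \<longleftrightarrow> (\<forall>l\<in>\<H> T. fst l \<bullet> x \<le> snd l)"
    by blast
  have "\<exists>H. \<forall>T\<in>\<T>. \<exists>c. \<forall>x\<in>P \<inter> T. H x = c + h T x"
  proof (rule global_potential_aux[where \<H> = \<H> and \<L> = "\<Union>(\<H> ` \<T>)"])
    show "finite (\<Union>(\<H> ` \<T>))" using assms(2) \<H>(1) by blast
  qed (use assms(1-3) \<H>(2) in \<open>blast intro: assms(5)\<close>)+
  then show ?thesis using that by blast
qed

section \<open>Triangles in the plane\<close>

lemma pt_nth [simp]: "pt z $ 1 = of_int (fst z)" "pt z $ 2 = of_int (snd z)"
  by (simp_all add: pt_def)

lemma vec2_eq_iff: "(x :: real^2) = y \<longleftrightarrow> x$1 = y$1 \<and> x$2 = y$2"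
  by (simp add: vec_eq_iff forall_2)

lemma pt_eq_iff [simp]: "pt y = pt z \<longleftrightarrow> y = z"
  by (auto simp: vec2_eq_iff prod_eq_iff)

lemma orient_affine:
  "u + v = 1 \<Longrightarrow> orient a b (u *\<^sub>R p + v *\<^sub>R q) = u * orient a b p + v * orient a b q"
proof -
  assume "u + v = 1"
  then have "v = 1 - u" by simp
  show ?thesis unfolding \<open>v = 1 - u\<close> by (simp add: orient_def algebra_simps)
qed

lemma orient_swap: "orient b a c = - orient a b c"
  by (simp add: orient_def algebra_simps)

lemma orient_degenerate [simp]: "orient a b a = 0" "orient a b b = 0" "orient a a b = 0"
  by (simp_all add: orient_def algebra_simps)

lemma orient_sum: "orient a b p + orient b c p + orient c a p = orient a b c"
  by (simp add: orient_def algebra_simps)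

text \<open>Cramer's rule with the denominators cleared: the three determinants are the barycentric
  coordinates of \<open>p\<close>, scaled by twice the signed area.\<close>

lemma barycentric:
  "orient a b c *\<^sub>R p = orient b c p *\<^sub>R a + orient c a p *\<^sub>R b + orient a b p *\<^sub>R c"
  by (simp add: vec2_eq_iff orient_def algebra_simps)

text \<open>Bridge from determinants to half-planes and hyperplanes, which are described by inner
  products.\<close>

lemma orient_eq_inner:
  obtains n \<beta> where "\<And>z. orient a b z = n \<bullet> z - \<beta>" "a \<noteq> b \<Longrightarrow> n \<noteq> 0"
proof
  let ?n = "vector [a$2 - b$2, b$1 - a$1] :: real^2"
  show "orient a b z = ?n \<bullet> z - ((a$2 - b$2) * a$1 + (b$1 - a$1) * a$2)" for z
    by (simp add: orient_def inner_vec_def sum_2 algebra_simps)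
  show "?n \<noteq> 0" if "a \<noteq> b" using that by (auto simp: vec2_eq_iff)
qed

lemma convex_left_halfplane: "convex {z. 0 \<le> orient a b z}"
proof -
  obtain n \<beta> where n: "\<And>z. orient a b z = n \<bullet> z - \<beta>" by (rule orient_eq_inner[of a b]) blast
  have "{z. 0 \<le> orient a b z} = {z. n \<bullet> z \<ge> \<beta>}" by (auto simp: n)
  then show ?thesis by (simp add: convex_halfspace_ge)
qed

lemma hull_left_halfplane:
  "(\<And>v. v \<in> S \<Longrightarrow> 0 \<le> orient a b v) \<Longrightarrow> x \<in> convex hull S \<Longrightarrow> 0 \<le> orient a b x"
  using hull_minimal[of S "{z. 0 \<le> orient a b z}" convex] convex_left_halfplane by blast

lemma mem_triangle_iff:
  assumes "0 < orient a b c"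
  shows "p \<in> convex hull {a, b, c} \<longleftrightarrow> 0 \<le> orient a b p \<and> 0 \<le> orient b c p \<and> 0 \<le> orient c a p"
proof
  assume p: "p \<in> convex hull {a, b, c}"
  have pos: "0 < orient b c a" "0 < orient c a b"
    using assms by (simp_all add: orient_def algebra_simps)
  show "0 \<le> orient a b p \<and> 0 \<le> orient b c p \<and> 0 \<le> orient c a p"
  proof (intro conjI)
    show "0 \<le> orient a b p" by (rule hull_left_halfplane[OF _ p]) (use assms in force)
    show "0 \<le> orient b c p" by (rule hull_left_halfplane[OF _ p]) (use pos in force)
    show "0 \<le> orient c a p" by (rule hull_left_halfplane[OF _ p]) (use pos in force)
  qed
next
  let ?d = "orient a b c"
  assume nonneg: "0 \<le> orient a b p \<and> 0 \<le> orient b c p \<and> 0 \<le> orient c a p"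
  have "p = inverse ?d *\<^sub>R (?d *\<^sub>R p)" using assms by simp
  also have "\<dots> = inverse ?d *\<^sub>R (orient b c p *\<^sub>R a + orient c a p *\<^sub>R b + orient a b p *\<^sub>R c)"
    by (simp only: barycentric[of a b c p])
  finally have p: "p = inverse ?d *\<^sub>R (orient b c p *\<^sub>R a + orient c a p *\<^sub>R b + orient a b p *\<^sub>R c)" .
  define u v w where uvw: "u = inverse ?d * orient b c p" "v = inverse ?d * orient c a p"
    "w = inverse ?d * orient a b p"
  have "u + v + w = inverse ?d * (orient a b p + orient b c p + orient c a p)"
    by (simp add: uvw algebra_simps)
  also have "\<dots> = 1" using assms by (simp add: orient_sum)
  finally have "u + v + w = 1" .
  moreover have "0 \<le> u" "0 \<le> v" "0 \<le> w" using nonneg assms by (simp_all add: uvw)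
  moreover have "p = u *\<^sub>R a + v *\<^sub>R b + w *\<^sub>R c"
    by (subst p) (simp add: uvw scaleR_add_right)
  ultimately show "p \<in> convex hull {a, b, c}"
    unfolding convex_hull_3 by blast
qed

lemma collinear_iff_orient: "collinear {a, b, c} \<longleftrightarrow> orient a b c = 0"
proof
  assume "collinear {a, b, c}"
  then show "orient a b c = 0"
    unfolding collinear_3_expand
  proof
    assume "\<exists>u. b = u *\<^sub>R a + (1 - u) *\<^sub>R c"
    then obtain u where u: "b = u *\<^sub>R a + (1 - u) *\<^sub>R c" by blast
    show ?thesis unfolding u by (simp add: orient_def algebra_simps)
  qed simp
next
  assume *: "orient a b c = 0"
  show "collinear {a, b, c}"
  proof (cases "a = c")
    case False
    then consider "a$1 \<noteq> c$1" | "a$2 \<noteq> c$2" by (auto simp: vec2_eq_iff)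
    then obtain u where "b = u *\<^sub>R a + (1 - u) *\<^sub>R c"
    proof cases
      case 1
      define u where "u = (b$1 - c$1) / (a$1 - c$1)"
      have 11: "u * (a$1 - c$1) = b$1 - c$1" using 1 by (simp add: u_def)
      have "(a$1 - c$1) * (u * (a$2 - c$2)) = (u * (a$1 - c$1)) * (a$2 - c$2)" by simp
      also have "\<dots> = (a$1 - c$1) * (b$2 - c$2)"
        unfolding 11 using * by (simp add: orient_def algebra_simps)
      finally have "u * (a$2 - c$2) = b$2 - c$2" using 1 by simp
      then show ?thesis
        using 11 by (intro that[of u]) (simp add: vec2_eq_iff algebra_simps)
    next
      case 2
      define u where "u = (b$2 - c$2) / (a$2 - c$2)"
      have 22: "u * (a$2 - c$2) = b$2 - c$2" using 2 by (simp add: u_def)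
      have "(a$2 - c$2) * (u * (a$1 - c$1)) = (u * (a$2 - c$2)) * (a$1 - c$1)" by simp
      also have "\<dots> = (a$2 - c$2) * (b$1 - c$1)"
        unfolding 22 using * by (simp add: orient_def algebra_simps)
      finally have "u * (a$1 - c$1) = b$1 - c$1" using 2 by simp
      then show ?thesis
        using 22 by (intro that[of u]) (simp add: vec2_eq_iff algebra_simps)
    qed
    then show ?thesis unfolding collinear_3_expand by blast
  qed (simp add: insert_commute)
qed

lemma triangle_ccwE:
  assumes "triangle T"
  obtains a b c where "0 < orient a b c" "T = convex hull {a, b, c}"
proof -
  obtain a b c where T: "orient a b c \<noteq> 0" "T = convex hull {a, b, c}"
    using assms by (auto simp: triangle_def collinear_iff_orient)
  show ?thesis
  proof (cases "0 < orient a b c")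
    case False
    moreover have "orient a c b = - orient a b c" by (simp add: orient_def algebra_simps)
    ultimately show ?thesis
      using T that[of a c b] by (simp add: insert_commute)
  qed (use T that in blast)
qed

lemma vertices_triangle:
  assumes "orient a b c \<noteq> 0"
  shows "vertices (convex hull {a, b, c}) = {a, b, c}"
proof -
  have "\<not> affine_dependent {a, b, c}"
    using assms collinear_iff_orient[of a b c] by (auto simp: collinear_3_eq_affine_dependent)
  then show ?thesis by (auto simp: vertices_def extreme_point_of_convex_hull_affine_independent)
qed

lemma area_triangle: "area (convex hull {a, b, c}) = \<bar>orient a b c\<bar> / 2"
  unfolding area_def content_triangle by (simp add: orient_def algebra_simps abs_minus_commute)

section \<open>Lattice triangles and parity\<close>

definition int_orient :: "int \<times> int \<Rightarrow> int \<times> int \<Rightarrow> int \<times> int \<Rightarrow> int" where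
  "int_orient a b p = (fst b - fst a) * (snd p - snd a) - (snd b - snd a) * (fst p - fst a)"

lemma orient_pt: "orient (pt a) (pt b) (pt c) = of_int (int_orient a b c)"
  by (simp add: orient_def int_orient_def)

text \<open>Three points of the affine plane over \<open>F\<^sub>2\<close> are affinely independent iff they are distinct.\<close>

lemma even_int_orient_iff:
  "even (int_orient a b c) \<longleftrightarrow> \<not> distinct [color_of a, color_of b, color_of c]"
proof -
  have even: "even (int_orient a b c) \<longleftrightarrow>
    ((even (fst b) \<longleftrightarrow> even (fst a)) \<or> (even (snd c) \<longleftrightarrow> even (snd a)) \<longleftrightarrow>
     (even (snd b) \<longleftrightarrow> even (snd a)) \<or> (even (fst c) \<longleftrightarrow> even (fst a)))"
    by (simp add: int_orient_def)
  show ?thesis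
    unfolding even color_of_def
    by (cases "even (fst a)"; cases "even (snd a)"; cases "even (fst b)"; cases "even (snd b)";
        cases "even (fst c)"; cases "even (snd c)") simp_all
qed

lemma lattice_triangleE:
  assumes "lattice_triangle T"
  obtains a b c where "0 < int_orient a b c" "T = convex hull {pt a, pt b, pt c}"
proof -
  have "triangle T" using assms by (simp add: lattice_triangle_def)
  then obtain a b c where T: "0 < orient a b c" "T = convex hull {a, b, c}"
    by (rule triangle_ccwE)
  moreover have "{a, b, c} \<subseteq> range pt"
    using assms T vertices_triangle[of a b c] by (auto simp: lattice_triangle_def)
  ultimately show ?thesis using that by (auto simp: orient_pt)
qed

lemma lattice_triangleI:
  assumes "int_orient a b c \<noteq> 0"
  shows "lattice_triangle (convex hull {pt a, pt b, pt c})"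
proof -
  have "orient (pt a) (pt b) (pt c) \<noteq> 0" using assms by (simp add: orient_pt)
  then show ?thesis
    by (auto simp: lattice_triangle_def vertices_triangle triangle_def collinear_iff_orient)
qed

lemma integer_area_iff:
  "area (convex hull {pt a, pt b, pt c}) \<in> \<int> \<longleftrightarrow>
     \<not> distinct [color_of a, color_of b, color_of c]"
proof -
  have "area (convex hull {pt a, pt b, pt c}) = of_int \<bar>int_orient a b c\<bar> / 2"
    by (simp add: area_triangle orient_pt)
  also have "\<dots> \<in> \<int> \<longleftrightarrow> even (int_orient a b c)"
  proof
    assume "of_int \<bar>int_orient a b c\<bar> / 2 \<in> (\<int> :: real set)"
    then obtain k where "of_int \<bar>int_orient a b c\<bar> / 2 = (of_int k :: real)" by (auto elim: Ints_cases)
    then have "of_int \<bar>int_orient a b c\<bar> = (of_int (2 * k) :: real)" by simp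
    then have "\<bar>int_orient a b c\<bar> = 2 * k" by (simp only: of_int_eq_iff)
    then show "even (int_orient a b c)" by presburger
  next
    assume "even (int_orient a b c)"
    then obtain k where "int_orient a b c = 2 * k" by blast
    then show "of_int \<bar>int_orient a b c\<bar> / 2 \<in> (\<int> :: real set)" by (simp add: abs_mult)
  qed
  finally show ?thesis by (simp add: even_int_orient_iff)
qed

lemma open_set_not_in_line:
  assumes "open U" "U \<noteq> {}" "a \<noteq> b"
  shows "\<exists>x\<in>U. orient a b x \<noteq> 0"
proof -
  obtain n \<beta> where n: "\<And>z. orient a b z = n \<bullet> z - \<beta>" "n \<noteq> 0"
    using orient_eq_inner assms(3) by metis
  have "interior {z. n \<bullet> z = \<beta>} = {}" using n by (simp add: interior_hyperplane)
  then have "\<not> U \<subseteq> {z. n \<bullet> z = \<beta>}" using assms by (metis interior_maximal subset_empty)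
  then show ?thesis by (auto simp: n)
qed

text \<open>An overlap of the interiors would be a nonempty open set contained in the line through
  \<open>a\<close> and \<open>b\<close>.\<close>

lemma disjoint_interiors_if_separated:
  assumes "a \<noteq> b" "\<And>x. x \<in> S \<Longrightarrow> orient a b x \<le> 0" "\<And>x. x \<in> T \<Longrightarrow> 0 \<le> orient a b x"
  shows "interior S \<inter> interior T = {}"
proof (rule ccontr)
  assume "interior S \<inter> interior T \<noteq> {}"
  then obtain x where "x \<in> interior S \<inter> interior T" "orient a b x \<noteq> 0"
    using open_set_not_in_line[of "interior S \<inter> interior T" a b] assms(1) by auto
  then show False using assms(2,3) interior_subset by (metis IntE antisym subsetD)
qed

lemma dissection_refine:
  assumes "dissection P \<T>" "\<And>T. T \<in> \<T> \<Longrightarrow> dissection T (f T)"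
  shows "dissection P (\<Union>(f ` \<T>))"
proof -
  have "interior S1 \<inter> interior S2 = {}"
    if "T1 \<in> \<T>" "T2 \<in> \<T>" "S1 \<in> f T1" "S2 \<in> f T2" "S1 \<noteq> S2" for T1 T2 S1 S2
  proof (cases "T1 = T2")
    case True
    then show ?thesis
      using assms(2)[OF that(1)] that(3-5) by (auto simp: dissection_def dest: pairwiseD)
  next
    case False
    then have "interior T1 \<inter> interior T2 = {}"
      using assms(1) that(1,2) by (auto simp: dissection_def dest: pairwiseD)
    moreover have "S1 \<subseteq> T1" "S2 \<subseteq> T2"
      using assms(2)[OF that(1)] assms(2)[OF that(2)] that(3,4) by (auto simp: dissection_def)
    ultimately show ?thesis using interior_mono by blast
  qed
  then have "pairwise (\<lambda>S T. interior S \<inter> interior T = {}) (\<Union>(f ` \<T>))"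
    unfolding pairwise_def by blast
  moreover have "\<Union>(\<Union>(f ` \<T>)) = P"
    using assms by (fastforce simp: dissection_def)
  ultimately show ?thesis using assms by (auto simp: dissection_def)
qed

section \<open>Integer-area dissections have contractible boundary\<close>

definition line_colors :: "(real^2) set \<Rightarrow> color set" where
  "line_colors L = {color_of z | z. pt z \<in> L}"

lemma color_in_line_colors: "pt z \<in> L \<Longrightarrow> color_of z \<in> line_colors L"
  unfolding line_colors_def by blast

text \<open>
  A point of a lattice line is assigned one of the (at most two) colors on that line; for points
  that are not lattice points the choice is arbitrary but depends only on the line.
\<close>

definition point_color :: "(real^2) set \<Rightarrow> real^2 \<Rightarrow> color" where
  "point_color L x =
     (if x \<in> range pt then color_of (inv pt x) else (SOME X. X \<in> line_colors L))"

lemma inj_pt: "inj pt"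
  by (rule injI) simp

lemma point_color_pt [simp]: "point_color L (pt z) = color_of z"
  by (simp add: point_color_def inv_f_f inj_pt)

lemma point_color_in_line_colors:
  assumes "x \<in> L" "line_colors L \<noteq> {}"
  shows "point_color L x \<in> line_colors L"
proof (cases "x \<in> range pt")
  case True
  then obtain z where "x = pt z" by blast
  with assms(1) show ?thesis by (simp add: color_in_line_colors)
next
  case False
  then show ?thesis using assms(2) by (simp add: point_color_def some_in_eq)
qed

lemma orient_eq_0_on_line:
  assumes "n \<noteq> 0" "n \<bullet> a = \<beta>" "n \<bullet> b = \<beta>" "n \<bullet> c = \<beta>"
  shows "orient a b c = 0"
proof -
  have ab: "n$1 * (b$1 - a$1) = - n$2 * (b$2 - a$2)" and ac: "n$1 * (c$1 - a$1) = - n$2 * (c$2 - a$2)"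
    using assms(2-4) by (auto simp: inner_vec_def sum_2 algebra_simps)
  have "n$1 * orient a b c =
      (n$1 * (b$1 - a$1)) * (c$2 - a$2) - (b$2 - a$2) * (n$1 * (c$1 - a$1))"
    by (simp add: orient_def algebra_simps)
  also have "\<dots> = 0" unfolding ab ac by simp
  finally have 1: "n$1 * orient a b c = 0" .
  have "n$2 * orient a b c =
      (b$1 - a$1) * (n$2 * (c$2 - a$2)) - (n$2 * (b$2 - a$2)) * (c$1 - a$1)"
    by (simp add: orient_def algebra_simps)
  also have "n$2 * (c$2 - a$2) = - n$1 * (c$1 - a$1)" using ac by simp
  also have "n$2 * (b$2 - a$2) = - n$1 * (b$1 - a$1)" using ab by simp
  finally have "n$2 * orient a b c = 0" by simp
  with 1 show ?thesis using assms(1) by (auto simp: vec2_eq_iff)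
qed

lemma line_eq_orient:
  assumes "n \<noteq> 0" "n \<bullet> a = \<beta>" "n \<bullet> b = \<beta>" "a \<noteq> b"
  shows "{z. n \<bullet> z = \<beta>} = {z. orient a b z = 0}"
proof (intro Collect_cong iffI)
  fix z assume "orient a b z = 0"
  then have "collinear {a, z, b}"
    by (simp add: collinear_iff_orient) (simp add: orient_def algebra_simps)
  then obtain u where z: "z = u *\<^sub>R a + (1 - u) *\<^sub>R b"
    using assms(4) unfolding collinear_3_expand by blast
  show "n \<bullet> z = \<beta>" unfolding z by (simp add: inner_add_right assms) (simp add: algebra_simps)
qed (use assms orient_eq_0_on_line in blast)

text \<open>Three lattice points on a line have determinant 0, which is even, so two of them share a
  color.\<close>

lemma line_colors_not_distinct:
  assumes "n \<noteq> 0" "X \<in> line_colors {z. n \<bullet> z = \<beta>}" "Y \<in> line_colors {z. n \<bullet> z = \<beta>}"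
    "Z \<in> line_colors {z. n \<bullet> z = \<beta>}"
  shows "\<not> distinct [X, Y, Z]"
proof -
  obtain x y z where xyz: "X = color_of x" "Y = color_of y" "Z = color_of z"
    "n \<bullet> pt x = \<beta>" "n \<bullet> pt y = \<beta>" "n \<bullet> pt z = \<beta>"
    using assms(2-4) by (auto simp: line_colors_def)
  have "int_orient x y z = 0"
    using orient_eq_0_on_line[OF assms(1) xyz(4-6)] by (simp add: orient_pt)
  then show ?thesis using even_int_orient_iff[of x y z] xyz(1-3) by simp
qed

lemma triangle_vertex_if_orient_0:
  assumes "orient c a p = 0" "orient a b p = 0" "0 < orient a b c"
  shows "p = a"
proof -
  have "orient b c p = orient a b c" using orient_sum[of a b p c] assms by linarith
  then have "orient a b c *\<^sub>R p = orient a b c *\<^sub>R a"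
    unfolding barycentric[of a b c p] assms(1,2) by simp
  then show ?thesis using assms(3) by simp
qed

text \<open>No corner lies below the line, so a point of the triangle on it puts positive weight
  only on corners that lie on it. Two distinct such points require two corners there, which
  determine a side.\<close>

lemma supporting_line_of_triangle:
  assumes pos: "0 < orient a b c" and T: "T = convex hull {a, b, c}"
    and n: "n \<noteq> 0" "\<And>z. z \<in> T \<Longrightarrow> \<beta> \<le> n \<bullet> z"
    and xy: "x \<in> T" "y \<in> T" "n \<bullet> x = \<beta>" "n \<bullet> y = \<beta>" "x \<noteq> y"
  shows "{z. n \<bullet> z = \<beta>} \<in> {{z. orient a b z = 0}, {z. orient b c z = 0}, {z. orient c a z = 0}}"
proof -
  have abc: "\<beta> \<le> n \<bullet> a" "\<beta> \<le> n \<bullet> b" "\<beta> \<le> n \<bullet> c" using n(2) T by (auto simp: hull_inc)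
  have ne: "a \<noteq> b" "b \<noteq> c" "c \<noteq> a" using pos by auto
  have zero: "(orient b c p = 0 \<or> n \<bullet> a = \<beta>) \<and> (orient c a p = 0 \<or> n \<bullet> b = \<beta>) \<and>
      (orient a b p = 0 \<or> n \<bullet> c = \<beta>)" if p: "p \<in> T" "n \<bullet> p = \<beta>" for p
  proof -
    have "orient a b c * (n \<bullet> p) = n \<bullet> (orient a b c *\<^sub>R p)" by simp
    also have "\<dots> = orient b c p * (n \<bullet> a) + orient c a p * (n \<bullet> b) + orient a b p * (n \<bullet> c)"
      by (subst barycentric) (simp add: inner_add_right)
    finally have eq: "orient b c p * (n \<bullet> a) + orient c a p * (n \<bullet> b) + orient a b p * (n \<bullet> c) =
        orient a b c * \<beta>"
      by (simp only: p(2))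
    have "orient b c p * (n \<bullet> a - \<beta>) + orient c a p * (n \<bullet> b - \<beta>) + orient a b p * (n \<bullet> c - \<beta>) =
        (orient b c p * (n \<bullet> a) + orient c a p * (n \<bullet> b) + orient a b p * (n \<bullet> c)) -
        (orient a b p + orient b c p + orient c a p) * \<beta>"
      by (simp add: algebra_simps)
    also have "\<dots> = 0" unfolding eq orient_sum by simp
    finally have "orient b c p * (n \<bullet> a - \<beta>) + orient c a p * (n \<bullet> b - \<beta>) +
        orient a b p * (n \<bullet> c - \<beta>) = 0" .
    moreover have "0 \<le> orient b c p * (n \<bullet> a - \<beta>)" "0 \<le> orient c a p * (n \<bullet> b - \<beta>)"
      "0 \<le> orient a b p * (n \<bullet> c - \<beta>)"
      using p(1) abc mem_triangle_iff[OF pos, of p] unfolding T by simp_all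
    ultimately have "orient b c p * (n \<bullet> a - \<beta>) = 0 \<and> orient c a p * (n \<bullet> b - \<beta>) = 0 \<and>
      orient a b p * (n \<bullet> c - \<beta>) = 0" by linarith
    then show ?thesis by auto
  qed
  note vertex = triangle_vertex_if_orient_0
  have rot: "0 < orient b c a" "0 < orient c a b"
    using pos by (simp_all add: orient_def algebra_simps)
  have "n \<bullet> a = \<beta> \<and> n \<bullet> b = \<beta> \<or> n \<bullet> b = \<beta> \<and> n \<bullet> c = \<beta> \<or> n \<bullet> c = \<beta> \<and> n \<bullet> a = \<beta>"
    using zero[OF xy(1,3)] zero[OF xy(2,4)] xy(5) vertex[OF _ _ pos] vertex[OF _ _ rot(1)]
      vertex[OF _ _ rot(2)] by metis
  then have "{z. n \<bullet> z = \<beta>} = {z. orient a b z = 0} \<or> {z. n \<bullet> z = \<beta>} = {z. orient b c z = 0} \<or>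
      {z. n \<bullet> z = \<beta>} = {z. orient c a z = 0}"
    using line_eq_orient[OF n(1) _ _ ne(1)] line_eq_orient[OF n(1) _ _ ne(2)]
      line_eq_orient[OF n(1) _ _ ne(3)] by blast
  then show ?thesis by (simp only: insert_iff empty_iff simp_thms)
qed

text \<open>The change of \<open>h\<close> along a side of \<open>T\<close> is determined by the line of that side alone.\<close>

definition color_potential ::
  "(real^2) set \<Rightarrow> (real^2 \<Rightarrow> (color \<times> color) list bijection) \<Rightarrow> bool" where
  "color_potential T h \<longleftrightarrow>
     (\<forall>n \<beta>. n \<noteq> 0 \<and> (\<forall>z\<in>T. \<beta> \<le> n \<bullet> z) \<longrightarrow>
        (\<forall>x\<in>T. \<forall>y\<in>T. n \<bullet> x = \<beta> \<and> n \<bullet> y = \<beta> \<and> x \<noteq> y \<longrightarrow>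
           - h x + h y = gen (point_color {z. n \<bullet> z = \<beta>} x) (point_color {z. n \<bullet> z = \<beta>} y)))"

lemma color_potentialD:
  assumes "color_potential T h" "n \<noteq> 0" "\<And>z. z \<in> T \<Longrightarrow> \<beta> \<le> n \<bullet> z" "x \<in> T" "y \<in> T"
    "n \<bullet> x = \<beta>" "n \<bullet> y = \<beta>" "x \<noteq> y"
  shows "- h x + h y = gen (point_color {z. n \<bullet> z = \<beta>} x) (point_color {z. n \<bullet> z = \<beta>} y)"
  using assms unfolding color_potential_def by blast

text \<open>Two corners share a color \<open>X\<close>, and every side contains one of them, so each
  side line carries \<open>X\<close> and at most one further color. All edges in question belong to
  the star centred at \<open>X\<close>; the edge from \<open>X\<close> to the color of a point is
  its potential.\<close>

lemma triangle_potential: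
  assumes "lattice_triangle T" "area T \<in> \<int>"
  shows "\<exists>h. color_potential T h"
proof -
  obtain a' b' c' where abc': "0 < int_orient a' b' c'" "T = convex hull {pt a', pt b', pt c'}"
    using assms(1) by (rule lattice_triangleE)
  define a b c where "a = pt a'" "b = pt b'" "c = pt c'"
  note abc = this
  have pos: "0 < orient a b c" using abc' by (simp add: abc orient_pt)
  have T: "T = convex hull {a, b, c}" using abc' abc by simp
  have "\<not> distinct [color_of a', color_of b', color_of c']"
    using assms(2) integer_area_iff[of a' b' c'] abc'(2) by simp
  then obtain X where X: "color_of a' = X \<and> color_of b' = X \<or> color_of b' = X \<and> color_of c' = X \<or>
      color_of c' = X \<and> color_of a' = X"
    by auto
  let ?ab = "{z. orient a b z = 0}" and ?bc = "{z. orient b c z = 0}" and ?ca = "{z. orient c a z = 0}"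
  have X_in: "X \<in> line_colors L" if "L \<in> {?ab, ?bc, ?ca}" for L
  proof -
    have "color_of a' \<in> line_colors ?ab" "color_of b' \<in> line_colors ?ab"
      "color_of b' \<in> line_colors ?bc" "color_of c' \<in> line_colors ?bc"
      "color_of c' \<in> line_colors ?ca" "color_of a' \<in> line_colors ?ca"
      by (simp_all add: color_in_line_colors abc)
    then show ?thesis using that X by (elim insertE) auto
  qed
  \<comment> \<open>A color must be chosen without reference to a line. This is consistent because a
    point on two side lines is a corner, hence a lattice point. Interior points get a default value:
    no supporting line passes through them.\<close>
  define \<kappa> where "\<kappa> x = (if x \<in> ?ab then point_color ?ab x else if x \<in> ?bc then point_color ?bc x
      else point_color ?ca x)" for x
  have \<kappa>: "\<kappa> x = point_color L x" if x: "x \<in> L" and L: "L \<in> {?ab, ?bc, ?ca}" for x L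
  proof (cases "x \<in> range pt")
    case True
    then show ?thesis by (auto simp: \<kappa>_def)
  next
    case False
    then have "x \<notin> {a, b, c}" by (auto simp: abc)
    moreover have "0 < orient b c a" "0 < orient c a b"
      using pos by (simp_all add: orient_def algebra_simps)
    moreover note triangle_vertex_if_orient_0[of c a x b] triangle_vertex_if_orient_0[of a b x c]
      triangle_vertex_if_orient_0[of b c x a] pos
    ultimately show ?thesis using x L by (auto simp: \<kappa>_def)
  qed
  have "color_potential T (\<lambda>x. gen X (\<kappa> x))"
    unfolding color_potential_def
  proof (intro allI impI ballI, elim conjE)
    fix n \<beta> x y
    assume asm: "n \<noteq> 0" "\<forall>z\<in>T. \<beta> \<le> n \<bullet> z" "x \<in> T" "y \<in> T" "n \<bullet> x = \<beta>" "n \<bullet> y = \<beta>" "x \<noteq> y"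
    define L where "L = {z. n \<bullet> z = \<beta>}"
    have L: "L \<in> {?ab, ?bc, ?ca}"
      unfolding L_def by (rule supporting_line_of_triangle[OF pos T asm(1) bspec[OF asm(2)] asm(3-)])
    have in_L: "x \<in> L" "y \<in> L" using asm by (auto simp: L_def)
    have ne: "line_colors L \<noteq> {}" using X_in[OF L] by auto
    have "\<not> distinct [point_color L x, X, point_color L y]"
      using line_colors_not_distinct[OF asm(1), of _ \<beta>] X_in[OF L]
        point_color_in_line_colors[OF in_L(1) ne] point_color_in_line_colors[OF in_L(2) ne]
      unfolding L_def by blast
    then show "- gen X (\<kappa> x) + gen X (\<kappa> y) =
        gen (point_color {z. n \<bullet> z = \<beta>} x) (point_color {z. n \<bullet> z = \<beta>} y)"
      unfolding L_def[symmetric] \<kappa>[OF in_L(1) L] \<kappa>[OF in_L(2) L] gen_swap by (rule gen_add)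
  qed
  then show ?thesis by blast
qed

lemma triangle_interior_nonempty: "triangle T \<Longrightarrow> interior T \<noteq> {}"
proof -
  assume "triangle T"
  then obtain a b c where T: "0 < orient a b c" "T = convex hull {a, b, c}" by (rule triangle_ccwE)
  have "\<not> collinear {a, b, c}" using T(1) by (simp add: collinear_iff_orient)
  then have "\<not> affine_dependent {a, b, c}" "card {a, b, c} = Suc (DIM(real^2))"
    by (auto simp: collinear_3_eq_affine_dependent)
  then show ?thesis using interior_convex_hull_eq_empty[of "{a, b, c}"] T(2) by simp
qed

lemma triangle_polytope: "triangle T \<Longrightarrow> polytope T"
  unfolding triangle_def polytope_def by (metis finite.emptyI finite.insertI)

text \<open>Separation of the disjoint open interiors passes to their closures, which are the
  triangles themselves.\<close>

lemma separate_triangles: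
  assumes "triangle S" "triangle T" "interior S \<inter> interior T = {}"
  obtains n \<beta> where "n \<noteq> 0" "\<And>z. z \<in> S \<Longrightarrow> n \<bullet> z \<le> \<beta>" "\<And>z. z \<in> T \<Longrightarrow> \<beta> \<le> n \<bullet> z"
proof -
  have conv: "convex S" "convex T" "closed S" "closed T"
    using assms triangle_polytope polytope_imp_convex polytope_imp_closed by blast+
  obtain n \<beta> where n: "n \<noteq> 0" "\<forall>x\<in>interior S. n \<bullet> x \<le> \<beta>" "\<forall>x\<in>interior T. \<beta> \<le> n \<bullet> x"
    using separating_hyperplane_sets[of "interior S" "interior T"] conv assms
      triangle_interior_nonempty by (metis convex_interior)
  have "S = closure (interior S)" "T = closure (interior T)"
    using conv assms triangle_interior_nonempty by (simp_all add: convex_closure_interior)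
  moreover have "closure (interior S) \<subseteq> {x. n \<bullet> x \<le> \<beta>}"
    using n by (intro closure_minimal closed_halfspace_le) auto
  moreover have "closure (interior T) \<subseteq> {x. n \<bullet> x \<ge> \<beta>}"
    using n by (intro closure_minimal closed_halfspace_ge) auto
  ultimately show ?thesis using that[of n \<beta>] n(1) by blast
qed

lemma holonomy_telescope:
  assumes "\<And>i. Suc i < length u \<Longrightarrow> H (u ! Suc i) = H (u ! i) + gen (f (u ! i)) (f (u ! Suc i))" "u \<noteq> []"
  shows "H (last u) = H (hd u) + holonomy (map f u)"
  using assms
proof (induction u)
  case (Cons x u)
  show ?case
  proof (cases u)
    case (Cons y v)
    have "H (last u) = H (hd u) + holonomy (map f u)"
    proof (rule Cons.IH)
      show "H (u ! Suc i) = H (u ! i) + gen (f (u ! i)) (f (u ! Suc i))" if "Suc i < length u" for i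
        using Cons.prems(1)[of "Suc i"] that by simp
    qed (simp add: Cons)
    moreover have "H y = H x + gen (f x) (f y)" using Cons.prems(1)[of 0] Cons by simp
    ultimately show ?thesis using Cons by (simp add: add.assoc)
  qed simp
qed simp

theorem integer_dissection_imp_contractible:
  assumes "convex P" "integer_area_dissectable P" "ccw_vertex_list P vs" "vs \<noteq> []"
  shows "contractible_word (boundary_word vs)"
proof -
  obtain \<T> where \<T>: "dissection P \<T>" "\<And>T. T \<in> \<T> \<Longrightarrow> lattice_triangle T" "\<And>T. T \<in> \<T> \<Longrightarrow> area T \<in> \<int>"
    using assms(2) by (auto simp: integer_area_dissectable_def)
  have tri: "triangle T" if "T \<in> \<T>" for T using \<T>(2)[OF that] by (simp add: lattice_triangle_def)
  have fin: "finite \<T>" and cover: "\<Union>\<T> = P"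
    and disj: "pairwise (\<lambda>S T. interior S \<inter> interior T = {}) \<T>"
    using \<T>(1) by (auto simp: dissection_def)
  have "\<forall>T\<in>\<T>. \<exists>h. color_potential T h" using triangle_potential \<T>(2,3) by blast
  from bchoice[OF this] obtain h where h: "\<And>T. T \<in> \<T> \<Longrightarrow> color_potential T (h T)" by blast
  have consistent: "- h S x + h S y = - h T x + h T y"
    if ST: "S \<in> \<T>" "T \<in> \<T>" "x \<in> S \<inter> T" "y \<in> S \<inter> T" for S T x y
  proof (cases "x = y \<or> S = T")
    case False
    then have "interior S \<inter> interior T = {}" using disj ST by (auto dest: pairwiseD)
    then obtain n \<beta> where n: "n \<noteq> 0" "\<And>z. z \<in> S \<Longrightarrow> n \<bullet> z \<le> \<beta>" "\<And>z. z \<in> T \<Longrightarrow> \<beta> \<le> n \<bullet> z"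
      using separate_triangles[OF tri[OF ST(1)] tri[OF ST(2)]] by blast
    \<comment> \<open>Common points lie on the separating line, which supports \<open>T\<close> and,
      with reversed normal, also \<open>S\<close>. It is the same line for both, so both potentials
      change by the same group element.\<close>
    have "n \<bullet> x = \<beta>" "n \<bullet> y = \<beta>" using n ST by (auto intro: antisym)
    then show ?thesis
      using color_potentialD[OF h[OF ST(2)] n(1), of \<beta> x y]
        color_potentialD[OF h[OF ST(1)], of "- n" "- \<beta>" x y] n ST False by simp
  qed auto
  have "polyhedron T" if "T \<in> \<T>" for T
    using tri[OF that] triangle_polytope polytope_imp_polyhedron by blast
  then obtain H where H: "\<And>T. T \<in> \<T> \<Longrightarrow> \<exists>g. \<forall>x\<in>P \<inter> T. H x = g + h T x"
    by (rule global_potential[OF assms(1) fin eq_refl[OF cover[symmetric]], of h])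
      (auto intro: consistent)
  \<comment> \<open>Along an edge of \<open>P\<close> the change of \<open>H\<close> depends only on
    the end colors, however many triangles subdivide the edge.\<close>
  have edge: "H (pt b) = H (pt a) + gen (color_of a) (color_of b)"
    if ab: "pt a \<in> P" "pt b \<in> P" "\<forall>p\<in>P. 0 \<le> orient (pt a) (pt b) p" for a b
  proof (cases "a = b")
    case False
    then have "pt a \<noteq> pt b" by simp
    then obtain n \<beta> where n: "\<And>z. orient (pt a) (pt b) z = n \<bullet> z - \<beta>" "n \<noteq> 0"
      using orient_eq_inner[of "pt a" "pt b"] by blast
    define L where "L = {z. n \<bullet> z = \<beta>}"
    have "n \<bullet> pt a = \<beta>" "n \<bullet> pt b = \<beta>" using n(1)[of "pt a"] n(1)[of "pt b"] by auto
    then have L: "pt a \<in> L" "pt b \<in> L" by (auto simp: L_def)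
    then have ne: "line_colors L \<noteq> {}" using color_in_line_colors by blast
    have "convex L" by (simp add: L_def convex_hyperplane)
    let ?K = "closed_segment (pt a) (pt b)"
    have K: "?K \<subseteq> L" "?K \<subseteq> P"
      using closed_segment_subset L \<open>convex L\<close> ab assms(1) by blast+
    \<comment> \<open>Appending the edge back to the color of \<open>a\<close> turns the expected
      behaviour of \<open>H\<close> into constancy, which connectedness of the segment can
      deliver.\<close>
    define \<phi> where "\<phi> x = H x + gen (point_color L x) (color_of a)" for x
    have "\<phi> (pt a) = \<phi> (pt b)"
    proof (rule locally_constant_on_finite_closed_cover[of ?K \<T>])
      show "closed T" if "T \<in> \<T>" for T
        using tri[OF that] triangle_polytope polytope_imp_closed by blast
      fix T x y assume T: "T \<in> \<T>" and xy: "x \<in> ?K \<inter> T" "y \<in> ?K \<inter> T"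
      show "\<phi> x = \<phi> y"
      proof (cases "x = y")
        case False
        have inL: "x \<in> L" "y \<in> L" using xy K by auto
        have "\<beta> \<le> n \<bullet> z" if "z \<in> T" for z
        proof -
          have "z \<in> P" using T cover that by blast
          then show ?thesis using n(1)[of z] ab(3) by force
        qed
        then have hT: "- h T x + h T y = gen (point_color L x) (point_color L y)"
          using color_potentialD[OF h[OF T] n(2), of \<beta> x y] inL xy False by (auto simp: L_def)
        obtain g where g: "\<forall>x\<in>P \<inter> T. H x = g + h T x" using H[OF T] by blast
        have "H y = H x + (- h T x + h T y)"
          using g xy K(2) by (simp add: add.assoc subset_iff)
        then have "\<phi> y = H x + (gen (point_color L x) (point_color L y) + gen (point_color L y) (color_of a))"
          unfolding hT \<phi>_def by (simp add: add.assoc)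
        also have "gen (point_color L x) (point_color L y) + gen (point_color L y) (color_of a) =
            gen (point_color L x) (color_of a)"
        proof (rule gen_add)
          have "color_of a \<in> line_colors L" using L(1) by (rule color_in_line_colors)
          then show "\<not> distinct [point_color L x, point_color L y, color_of a]"
            using line_colors_not_distinct[OF n(2), of _ \<beta>]
              point_color_in_line_colors[OF inL(1) ne] point_color_in_line_colors[OF inL(2) ne]
            unfolding L_def by blast
        qed
        finally show ?thesis by (simp add: \<phi>_def)
      qed simp
    qed (use fin cover K in auto)
    then have "H (pt a) = H (pt b) + gen (color_of b) (color_of a)" by (simp add: \<phi>_def)
    then show ?thesis by (simp add: add.assoc)
  qed simp
  let ?u = "vs @ [hd vs]"
  have "H (pt (last ?u)) = H (pt (hd ?u)) + holonomy (map color_of ?u)"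
  proof (rule holonomy_telescope[where H = "\<lambda>z. H (pt z)"])
    fix i assume i: "Suc i < length ?u"
    then have nth: "?u ! i = vs ! i" "?u ! Suc i = vs ! (Suc i mod length vs)"
      using assms(4) by (auto simp: nth_append hd_conv_nth less_Suc_eq)
    have "pt ` set vs = vertices P" using assms(3) by (simp add: ccw_vertex_list_def)
    then have "pt v \<in> P" if "v \<in> set vs" for v
      using that by (auto simp: vertices_def extreme_point_of_def)
    moreover have "Suc i mod length vs < length vs" using assms(4) by simp
    ultimately show "H (pt (?u ! Suc i)) = H (pt (?u ! i)) + gen (color_of (?u ! i)) (color_of (?u ! Suc i))"
      unfolding nth using i assms(3)
      by (intro edge) (auto simp: ccw_vertex_list_def)
  qed simp
  \<comment> \<open>The walk around \<open>P\<close> ends where it started, so the accumulated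
    holonomy cancels.\<close>
  then have "H (pt (hd vs)) + 0 = H (pt (hd vs)) + holonomy (map color_of ?u)"
    using assms(4) by simp
  then have "holonomy (map color_of ?u) = 0" by (simp only: add_left_cancel)
  then have "cyclic_holonomy (boundary_word vs) = 0"
    using assms(4) by (simp add: cyclic_holonomy_def boundary_word_def hd_map)
  then show ?thesis
    using contractible_iff_cyclic_holonomy[of "boundary_word vs"] assms(4)
    by (simp add: boundary_word_def)
qed

section \<open>Cutting off ears\<close>

text \<open>Every side of a piece joins two corners of \<open>P\<close>, so it is an edge of
  \<open>P\<close>, which lies in the frontier, or a diagonal, which is put into
  \<open>\<D>\<close>. Conversely, a frontier point of \<open>P\<close> lies in some piece but not
  in its interior.\<close>

lemma diagonal_dissectionI:
  assumes "polytope P" "dissection P \<T>" "\<And>T. T \<in> \<T> \<Longrightarrow> vertices T \<subseteq> vertices P"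
  shows "diagonal_dissection P \<T>"
proof -
  define \<D> where "\<D> = {closed_segment a b | a b.
    (\<exists>T\<in>\<T>. a \<in> vertices T \<and> b \<in> vertices T) \<and> a \<noteq> b \<and> \<not> closed_segment a b edge_of P}"
  have "\<D> \<subseteq> diagonals P"
    using assms(3) unfolding \<D>_def diagonals_def by blast
  moreover have "(\<Union>T\<in>\<T>. frontier T) = frontier P \<union> \<Union>\<D>"
  proof -
    have tri: "triangle T" "T \<subseteq> P" if "T \<in> \<T>" for T
      using assms(2) that by (auto simp: dissection_def)
    have frontier: "closed_segment a b \<subseteq> frontier T"
      if T: "triangle T" and ab: "a \<in> vertices T" "b \<in> vertices T" for T a b
    proof -
      obtain u v w where uvw: "0 < orient u v w" "T = convex hull {u, v, w}"
        using T by (rule triangle_ccwE)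
      have f: "frontier T = closed_segment u v \<union> closed_segment v w \<union> closed_segment w u"
        using uvw(2) by (simp add: frontier_of_triangle)
      have "vertices T = {u, v, w}" using uvw vertices_triangle[of u v w] by simp
      with ab have "a \<in> {u, v, w}" "b \<in> {u, v, w}" by simp_all
      then show ?thesis unfolding f by (auto simp: closed_segment_commute)
    qed
    have "x \<in> frontier P \<union> \<Union>\<D>" if T: "T \<in> \<T>" and x: "x \<in> frontier T" for T x
    proof -
      obtain u v w where uvw: "0 < orient u v w" "T = convex hull {u, v, w}"
        using tri(1)[OF T] by (rule triangle_ccwE)
      have V: "vertices T = {u, v, w}" using uvw vertices_triangle[of u v w] by simp
      have ne: "u \<noteq> v" "v \<noteq> w" "w \<noteq> u" using uvw(1) by auto
      have "x \<in> closed_segment u v \<union> closed_segment v w \<union> closed_segment w u"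
        using x uvw(2) by (simp add: frontier_of_triangle)
      then obtain a b where ab: "a \<in> vertices T" "b \<in> vertices T" "a \<noteq> b" "x \<in> closed_segment a b"
        using V ne by blast
      show ?thesis
      proof (cases "closed_segment a b edge_of P")
        case True
        then have face: "closed_segment a b face_of P" by (simp add: edge_of_def)
        have "P \<noteq> closed_segment a b"
        proof
          assume "P = closed_segment a b"
          then have "interior P = {}" by (simp add: interior_closed_segment_ge2)
          then show False
            using triangle_interior_nonempty[OF tri(1)[OF T]] interior_mono[OF tri(2)[OF T]] by blast
        qed
        then have "closed_segment a b \<inter> interior P = {}"
          using face_of_disjoint_interior[OF face] by blast
        moreover have "closed_segment a b \<subseteq> P" using face face_of_imp_subset by blast
        ultimately have "x \<in> frontier P"
          using ab(4) closure_subset by (auto simp: frontier_def)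
        then show ?thesis by blast
      next
        case False
        then have "closed_segment a b \<in> \<D>" using ab T unfolding \<D>_def by blast
        then show ?thesis using ab(4) by blast
      qed
    qed
    moreover have "x \<in> (\<Union>T\<in>\<T>. frontier T)" if x: "x \<in> frontier P" for x
    proof -
      have "closed P" using assms(1) polytope_imp_closed by blast
      then have "x \<in> P" "x \<notin> interior P" using x by (auto simp: frontier_def)
      then obtain T where T: "T \<in> \<T>" "x \<in> T" using assms(2) by (auto simp: dissection_def)
      then have "x \<notin> interior T" using \<open>x \<notin> interior P\<close> interior_mono[OF tri(2)[OF T(1)]] by blast
      then have "x \<in> frontier T" using T(2) closure_subset by (auto simp: frontier_def)
      then show ?thesis using T(1) by blast
    qed
    moreover have "\<Union>\<D> \<subseteq> (\<Union>T\<in>\<T>. frontier T)"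
      using frontier tri(1) unfolding \<D>_def by blast
    ultimately show ?thesis by blast
  qed
  ultimately show ?thesis using assms by (auto simp: diagonal_dissection_def)
qed

lemma triangle_side_mem:
  assumes "0 < orient a b c" "p \<in> convex hull {a, b, c}" "orient a b p = 0"
  shows "p \<in> closed_segment a b"
proof -
  let ?d = "orient a b c"
  have nonneg: "0 \<le> orient b c p" "0 \<le> orient c a p"
    using assms(2) mem_triangle_iff[OF assms(1), of p] by simp_all
  have sum: "orient b c p + orient c a p = ?d" using orient_sum[of a b p c] assms(3) by linarith
  define t where "t = orient c a p / ?d"
  have t: "0 \<le> t" "t \<le> 1" "1 - t = orient b c p / ?d"
    using nonneg sum assms(1) by (auto simp: t_def field_simps)
  have "?d *\<^sub>R p = orient b c p *\<^sub>R a + orient c a p *\<^sub>R b"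
    unfolding barycentric[of a b c p] assms(3) by simp
  also have "\<dots> = ?d *\<^sub>R ((1 - t) *\<^sub>R a + t *\<^sub>R b)"
    using assms(1) unfolding t(3) by (simp add: t_def scaleR_add_right)
  finally have "p = (1 - t) *\<^sub>R a + t *\<^sub>R b" using assms(1) by simp
  then show ?thesis using t(1,2) unfolding closed_segment_def by blast
qed

text \<open>A point of the large hull on or beyond the line from \<open>a\<close> to
  \<open>b\<close> satisfies all three inequalities of the ear. Any other point lies on a segment
  from some \<open>y\<close> in the hull of \<open>S\<close> to \<open>v\<close>, before that
  segment reaches the diagonal, and so between two points of the hull of \<open>S\<close>.\<close>

lemma convex_hull_insert_ear:
  assumes ear: "0 < orient b a v" and ab: "a \<in> S" "b \<in> S"
    and left: "\<And>x. x \<in> S \<Longrightarrow> 0 \<le> orient a v x" "\<And>x. x \<in> S \<Longrightarrow> 0 \<le> orient v b x"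
      "\<And>x. x \<in> S \<Longrightarrow> 0 \<le> orient a b x"
  shows "convex hull (insert v S) = convex hull S \<union> convex hull {b, a, v}"
proof
  show "convex hull S \<union> convex hull {b, a, v} \<subseteq> convex hull (insert v S)"
    using ab by (intro Un_least hull_mono) auto
  have fv: "orient a b v < 0" using ear orient_swap[of a b v] by simp
  have in_ear: "x \<in> convex hull {b, a, v}" if x: "x \<in> convex hull (insert v S)" "orient a b x \<le> 0" for x
  proof -
    have "0 \<le> orient a v x" by (rule hull_left_halfplane[OF _ x(1)]) (use left(1) in auto)
    moreover have "0 \<le> orient v b x" by (rule hull_left_halfplane[OF _ x(1)]) (use left(2) in auto)
    ultimately show ?thesis
      using x(2) orient_swap[of a b x] mem_triangle_iff[OF ear, of x] by simp
  qed
  show "convex hull (insert v S) \<subseteq> convex hull S \<union> convex hull {b, a, v}"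
  proof
    fix x assume x: "x \<in> convex hull (insert v S)"
    show "x \<in> convex hull S \<union> convex hull {b, a, v}"
    proof (cases "orient a b x \<le> 0")
      case True
      then show ?thesis using in_ear x by blast
    next
      case False
      have "S \<noteq> {}" using ab by auto
      then obtain u w y where uw: "0 \<le> u" "0 \<le> w" "u + w = 1" and y: "y \<in> convex hull S"
        and x_eq: "x = u *\<^sub>R v + w *\<^sub>R y"
        using x unfolding convex_hull_insert[OF \<open>S \<noteq> {}\<close>] by blast
      have fy: "0 \<le> orient a b y" by (rule hull_left_halfplane[OF left(3) y])
      have "orient a b x = u * orient a b v + w * orient a b y"
        unfolding x_eq by (rule orient_affine[OF uw(3)])
      then have fx: "0 < u * orient a b v + w * orient a b y" using False by simp
      define g where "g = orient a b y - orient a b v"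
      have g: "0 < g" using fv fy by (simp add: g_def)
      \<comment> \<open>The parameter at which the segment from \<open>y\<close> to \<open>v\<close>
        crosses the line through \<open>a\<close> and \<open>b\<close>; \<open>u < s\<close> places
        \<open>x\<close> before the crossing point \<open>z\<close>.\<close>
      define s where "s = orient a b y / g"
      have gs: "g * s = orient a b y" using g by (simp add: s_def)
      have "w = 1 - u" using uw(3) by simp
      then have "u * g < g * s"
        using fx unfolding gs \<open>w = 1 - u\<close> by (simp add: g_def algebra_simps)
      then have us: "u < s" using g by (simp add: mult.commute)
      have s1: "s \<le> 1" using fv g by (simp add: s_def g_def)
      define z where "z = s *\<^sub>R v + (1 - s) *\<^sub>R y"
      have "orient a b z = s * orient a b v + (1 - s) * orient a b y"
        unfolding z_def by (rule orient_affine) simp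
      also have "\<dots> = orient a b y - g * s" by (simp add: g_def algebra_simps)
      finally have fz: "orient a b z = 0" using gs by simp
      have "y \<in> convex hull (insert v S)" using y hull_mono[of S "insert v S"] by blast
      moreover have "v \<in> convex hull (insert v S)" by (simp add: hull_inc)
      ultimately have "z \<in> convex hull (insert v S)"
        unfolding z_def using us uw(1) s1 by (intro convexD[OF convex_convex_hull]) auto
      then have "z \<in> convex hull {b, a, v}" using in_ear fz by simp
      then have "z \<in> closed_segment b a"
        using fz orient_swap[of a b z] by (intro triangle_side_mem[OF ear]) auto
      also have "closed_segment b a \<subseteq> convex hull S"
        using ab by (simp add: closed_segment_subset_convex_hull hull_inc)
      finally have z: "z \<in> convex hull S" .
      have "0 < s" using us uw(1) by linarith
      define t where "t = u / s"
      have t: "0 \<le> t" "t \<le> 1" "t * s = u" using us uw(1) \<open>0 < s\<close> by (auto simp: t_def)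
      have "t *\<^sub>R z + (1 - t) *\<^sub>R y = (t * s) *\<^sub>R v + (1 - t * s) *\<^sub>R y"
        by (simp add: z_def algebra_simps)
      also have "\<dots> = x" unfolding t(3) x_eq \<open>w = 1 - u\<close> ..
      finally have "x = t *\<^sub>R z + (1 - t) *\<^sub>R y" ..
      then have "x \<in> convex hull S"
        using z y t by (auto intro!: convexD[OF convex_convex_hull])
      then show ?thesis by blast
    qed
  qed
qed

section \<open>Convex position and ears\<close>

definition convex_independent :: "(real^2) set \<Rightarrow> bool" where
  "convex_independent S \<longleftrightarrow> (\<forall>v\<in>S. v \<notin> convex hull (S - {v}))"

lemma convex_independentD:
  assumes "convex_independent S" "U \<subseteq> S" "v \<in> S" "v \<notin> U"
  shows "v \<notin> convex hull U"
proof -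
  have "U \<subseteq> S - {v}" using assms by blast
  then show ?thesis using assms(1,3) hull_mono unfolding convex_independent_def by blast
qed

lemma convex_independent_subset: "convex_independent S \<Longrightarrow> U \<subseteq> S \<Longrightarrow> convex_independent U"
  unfolding convex_independent_def[of U] using convex_independentD[of S "U - {v}" v for v] by blast

lemma convex_independent_orient:
  assumes "convex_independent S" "{a, b, c} \<subseteq> S" "a \<noteq> b" "b \<noteq> c" "a \<noteq> c"
  shows "orient a b c \<noteq> 0"
proof
  assume "orient a b c = 0"
  then have "collinear {a, b, c}" by (simp add: collinear_iff_orient)
  then have "a \<in> convex hull {b, c} \<or> b \<in> convex hull {c, a} \<or> c \<in> convex hull {a, b}"
    by (simp add: collinear_between_cases between_mem_segment segment_convex_hull)
  then show False
    using convex_independentD[OF assms(1), of "{b, c}" a] convex_independentD[OF assms(1), of "{c, a}" b]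
      convex_independentD[OF assms(1), of "{a, b}" c] assms(2-) by simp
qed

definition successive :: "'a list \<Rightarrow> ('a \<times> 'a) set" where
  "successive vs = set (zip vs (tl vs))"

text \<open>As a set of pairs it is invariant under rotation, so deleting a corner changes it
  without any index arithmetic.\<close>

definition cyclic_edges :: "'a list \<Rightarrow> ('a \<times> 'a) set" where
  "cyclic_edges vs = insert (last vs, hd vs) (successive vs)"

lemma successive_append:
  "u \<noteq> [] \<Longrightarrow> v \<noteq> [] \<Longrightarrow> successive (u @ v) = insert (last u, hd v) (successive u \<union> successive v)"
proof (induction u)
  case (Cons x u)
  then show ?case by (cases u; cases v) (simp_all add: successive_def insert_commute)
qed simp

lemma cyclic_edges_rotate: "cyclic_edges (u @ v) = cyclic_edges (v @ u)"
  by (cases "u = [] \<or> v = []") (auto simp: cyclic_edges_def successive_append hd_append)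

lemma cyclic_edges_Cons:
  "s \<noteq> [] \<Longrightarrow> cyclic_edges (v # s) = {(last s, v), (v, hd s)} \<union> successive s"
  using successive_append[of "[v]" s] by (auto simp: cyclic_edges_def successive_def)

lemma cyclic_edges_nth:
  assumes "vs \<noteq> []"
  shows "cyclic_edges vs = (\<lambda>i. (vs ! i, vs ! (Suc i mod length vs))) ` {..<length vs}"
proof -
  let ?f = "\<lambda>i. (vs ! i, vs ! (Suc i mod length vs))"
  obtain n where n: "length vs = Suc n" using assms by (cases vs) auto
  have "successive vs = (\<lambda>i. (vs ! i, vs ! Suc i)) ` {..<n}"
    by (auto simp: successive_def set_zip nth_tl n)
  also have "\<dots> = ?f ` {..<n}" by (rule image_cong) (simp_all add: n)
  also have "insert (last vs, hd vs) (?f ` {..<n}) = ?f ` {..<Suc n}"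
    using assms by (simp add: lessThan_Suc last_conv_nth hd_conv_nth n)
  finally show ?thesis unfolding cyclic_edges_def n .
qed

text \<open>A contracting step deletes a corner \<open>v\<close> that does not have a color triple
  of distinct letters with its neighbours, so the ear at \<open>v\<close> has integer area. The
  hypotheses speak only about the list of corners, because in this form they are inherited when an
  ear is removed; the recursion stops at a triangle, which is itself an ear.\<close>

lemma contractible_imp_ear_dissection:
  assumes "contracting_step\<^sup>*\<^sup>* w [X]" "w = map color_of vs" "3 \<le> length vs" "distinct vs"
    "convex_independent (pt ` set vs)"
    "\<And>a b v. (a, b) \<in> cyclic_edges vs \<Longrightarrow> v \<in> set vs \<Longrightarrow> 0 \<le> orient (pt a) (pt b) (pt v)"
  shows "\<exists>\<T>. dissection (convex hull (pt ` set vs)) \<T> \<and>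
    (\<forall>T\<in>\<T>. lattice_triangle T \<and> area T \<in> \<int> \<and> vertices T \<subseteq> pt ` set vs)"
  using assms
proof (induction arbitrary: vs rule: converse_rtranclp_induct)
  case base
  from arg_cong[OF base.prems(1), of length] have "length vs = 1" by simp
  then show ?case using base.prems(2) by simp
next
  case (step w w')
  obtain cp y cq where cw: "w = cp @ y # cq" "w' = cp @ cq"
    and nd: "\<not> distinct [last (cq @ cp), y, hd (cq @ cp)]"
    using step.hyps(1) unfolding contracting_step_iff by blast
  have "map color_of vs = cp @ y # cq" using cw(1) step.prems(1) by simp
  then obtain p v q where vs: "vs = p @ v # q" and pq: "cp = map color_of p" "y = color_of v" "cq = map color_of q"
    unfolding map_eq_append_conv map_eq_Cons_conv by blast
  define s where "s = q @ p"
  define a b where "a = last s" "b = hd s"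
  note ab_def = this
  have len: "2 \<le> length s" using step.prems(2) vs by (simp add: s_def)
  then have ne: "s \<noteq> []" by auto
  have "cq @ cp = map color_of s" by (simp add: s_def pq)
  then have cols: "\<not> distinct [color_of a, color_of v, color_of b]"
    using nd ne by (simp add: ab_def last_map hd_map pq)
  have set_vs: "set vs = insert v (set s)" by (auto simp: vs s_def)
  have dist: "distinct s" "v \<notin> set s" using step.prems(3) by (auto simp: vs s_def)
  have ab: "a \<in> set s" "b \<in> set s" using ne by (auto simp: ab_def)
  have "a \<noteq> b"
    using len dist(1) ne by (simp add: ab_def hd_conv_nth last_conv_nth nth_eq_iff_index_eq)
  have "a \<noteq> v" "b \<noteq> v" using ab dist by auto
  have edges: "cyclic_edges vs = {(a, v), (v, b)} \<union> successive s"
    using cyclic_edges_rotate[of p "v # q"] cyclic_edges_Cons[OF ne, of v] by (simp add: vs s_def ab_def)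
  have left: "0 \<le> orient (pt a) (pt v) (pt x)" "0 \<le> orient (pt v) (pt b) (pt x)"
    if "x \<in> set vs" for x
    using step.prems(5)[of a v x] step.prems(5)[of v b x] that edges by auto
  have "orient (pt b) (pt a) (pt v) \<noteq> 0"
    using ab set_vs \<open>a \<noteq> b\<close> \<open>a \<noteq> v\<close> \<open>b \<noteq> v\<close>
    by (intro convex_independent_orient[OF step.prems(4)]) auto
  moreover have "orient (pt b) (pt a) (pt v) = orient (pt a) (pt v) (pt b)"
    by (simp add: orient_def algebra_simps)
  ultimately have ear: "0 < orient (pt b) (pt a) (pt v)"
    using left(1)[of b] ab set_vs by simp
  let ?E = "convex hull {pt b, pt a, pt v}"
  have "int_orient b a v \<noteq> 0" using ear by (auto simp: orient_pt)
  then have E1: "lattice_triangle ?E" by (rule lattice_triangleI)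
  have E2: "area ?E \<in> \<int>" using cols by (simp add: integer_area_iff) metis
  have "vertices ?E = {pt b, pt a, pt v}" using ear by (intro vertices_triangle) simp
  then have E3: "vertices ?E \<subseteq> pt ` set vs" using ab set_vs by simp
  note E = E1 E2 E3
  \<comment> \<open>A corner on the wrong side of the new edge would lie in the ear, against convex
    independence. This supplies the orientation condition for the only edge of the smaller polygon
    that is not inherited.\<close>
  have diag: "0 \<le> orient (pt a) (pt b) (pt x)" if "x \<in> set s" for x
  proof (rule ccontr)
    assume neg: "\<not> 0 \<le> orient (pt a) (pt b) (pt x)"
    then have "pt x \<in> ?E"
      using mem_triangle_iff[OF ear, of "pt x"] left[of x] that set_vs
        orient_swap[of "pt a" "pt b" "pt x"] by simp
    moreover have "x \<noteq> a" "x \<noteq> b" "x \<noteq> v" using neg that dist by auto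
    ultimately show False
      using convex_independentD[OF step.prems(4), of "{pt b, pt a, pt v}" "pt x"] that ab set_vs by auto
  qed
  show ?case
  proof (cases "length vs = 3")
    case True
    then have "length s = 2" by (simp add: vs s_def)
    then obtain u1 u2 where "s = [u1, u2]" by (auto simp: numeral_2_eq_2 length_Suc_conv)
    then have "set s = {a, b}" by (auto simp: ab_def)
    then have hull: "convex hull (pt ` set vs) = ?E" using set_vs by (simp add: insert_commute)
    have "dissection ?E {?E}" using E(1) by (simp add: dissection_def lattice_triangle_def pairwise_def)
    then show ?thesis using E unfolding hull by blast
  next
    case False
    let ?vs' = "p @ q"
    have set': "set ?vs' = set s" by (auto simp: s_def)
    have edges': "cyclic_edges ?vs' = insert (a, b) (successive s)"
      using cyclic_edges_rotate[of p q] by (simp add: s_def cyclic_edges_def ab_def)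
    have "\<exists>\<T>. dissection (convex hull (pt ` set ?vs')) \<T> \<and>
      (\<forall>T\<in>\<T>. lattice_triangle T \<and> area T \<in> \<int> \<and> vertices T \<subseteq> pt ` set ?vs')"
    proof (rule step.IH)
      show "w' = map color_of ?vs'" by (simp add: cw pq)
      show "3 \<le> length ?vs'" using False step.prems(2) by (simp add: vs)
      show "distinct ?vs'" using dist by (auto simp: s_def)
      show "convex_independent (pt ` set ?vs')"
        using step.prems(4) set' set_vs by (auto elim: convex_independent_subset)
      show "0 \<le> orient (pt a') (pt b') (pt x)" if "(a', b') \<in> cyclic_edges ?vs'" "x \<in> set ?vs'" for a' b' x
      proof -
        have "x \<in> set s" "x \<in> set vs" using that(2) set' set_vs by auto
        moreover have "(a', b') = (a, b) \<or> (a', b') \<in> cyclic_edges vs" using that(1) edges' edges by blast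
        ultimately show ?thesis using diag[of x] step.prems(5)[of a' b' x] by blast
      qed
    qed
    then obtain \<T> where \<T>: "dissection (convex hull (pt ` set s)) \<T>"
      "\<forall>T\<in>\<T>. lattice_triangle T \<and> area T \<in> \<int> \<and> vertices T \<subseteq> pt ` set s"
      unfolding set' by blast
    have hull: "convex hull (pt ` set vs) = convex hull (pt ` set s) \<union> ?E"
      unfolding set_vs image_insert using ear ab left diag set_vs
      by (intro convex_hull_insert_ear) auto
    have disj: "interior ?E \<inter> interior (convex hull (pt ` set s)) = {}"
    proof (rule disjoint_interiors_if_separated[of "pt a" "pt b"])
      show "pt a \<noteq> pt b" using \<open>a \<noteq> b\<close> by simp
      show "0 \<le> orient (pt a) (pt b) x" if "x \<in> convex hull (pt ` set s)" for x
        by (rule hull_left_halfplane[OF _ that]) (use diag in auto)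
      show "orient (pt a) (pt b) x \<le> 0" if "x \<in> ?E" for x
        using mem_triangle_iff[OF ear, of x] that orient_swap[of "pt a" "pt b" x] by simp
    qed
    have "interior ?E \<inter> interior T = {}" if "T \<in> \<T>" for T
    proof -
      have "T \<subseteq> convex hull (pt ` set s)" using \<T>(1) that by (auto simp: dissection_def)
      then show ?thesis using disj interior_mono by blast
    qed
    then have "dissection (convex hull (pt ` set vs)) (insert ?E \<T>)"
      using \<T>(1) E(1) unfolding hull
      by (auto simp: dissection_def pairwise_insert lattice_triangle_def Int_commute)
    moreover have "\<forall>T\<in>insert ?E \<T>. lattice_triangle T \<and> area T \<in> \<int> \<and> vertices T \<subseteq> pt ` set vs"
      using \<T>(2) E set_vs by auto
    ultimately show ?thesis by blast
  qed
qed

theorem contractible_imp_diagonally_dissectable: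
  assumes "convex_lattice_polygon P" "ccw_vertex_list P vs" "contractible_word (boundary_word vs)"
  shows "integer_area_diagonally_dissectable P"
proof -
  have P: "polytope P" "interior P \<noteq> {}" using assms(1) by (auto simp: convex_lattice_polygon_def)
  have vs: "distinct vs" "pt ` set vs = vertices P"
    and left: "\<And>i p. i < length vs \<Longrightarrow> p \<in> P \<Longrightarrow>
      0 \<le> orient (pt (vs ! i)) (pt (vs ! (Suc i mod length vs))) p"
    using assms(2) by (auto simp: ccw_vertex_list_def)
  have hull: "P = convex hull (pt ` set vs)"
    unfolding vs(2) vertices_def using P(1) by (intro Krein_Milman_Minkowski)
      (auto simp: polytope_imp_compact polytope_imp_convex)
  have indep: "convex_independent (pt ` set vs)"
    unfolding convex_independent_def vs(2)
  proof
    fix v assume "v \<in> vertices P"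
    then have "v extreme_point_of P" by (simp add: vertices_def)
    then have "convex (P - {v})" using P(1) extreme_point_of_stillconvex polytope_imp_convex by blast
    moreover have "vertices P - {v} \<subseteq> P - {v}" by (auto simp: vertices_def extreme_point_of_def)
    ultimately have "convex hull (vertices P - {v}) \<subseteq> P - {v}" by (rule hull_minimal[rotated])
    then show "v \<notin> convex hull (vertices P - {v})" by blast
  qed
  have len: "3 \<le> length vs"
  proof (rule ccontr)
    assume "\<not> 3 \<le> length vs"
    then have "card (pt ` set vs) \<le> 2"
      using card_image_le[of "set vs" pt] card_length[of vs] by simp
    then have "interior (convex hull (pt ` set vs)) = {}"
      by (intro empty_interior_convex_hull) auto
    then show False using P(2) hull by simp
  qed
  have "\<exists>\<T>. dissection P \<T> \<and> (\<forall>T\<in>\<T>. lattice_triangle T \<and> area T \<in> \<int> \<and> vertices T \<subseteq> vertices P)"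
  proof -
    obtain X where X: "contracting_step\<^sup>*\<^sup>* (boundary_word vs) [X]"
      using assms(3) by (auto simp: contractible_word_def)
    show ?thesis
      unfolding vs(2)[symmetric]
    proof (subst hull, rule contractible_imp_ear_dissection[OF X _ len vs(1) indep])
      fix a b v assume ab: "(a, b) \<in> cyclic_edges vs" and v: "v \<in> set vs"
      have "pt v \<in> P" using v vs(2) by (auto simp: vertices_def extreme_point_of_def)
      moreover have "\<exists>i<length vs. a = vs ! i \<and> b = vs ! (Suc i mod length vs)"
      proof -
        have "vs \<noteq> []" using len by auto
        from ab[unfolded cyclic_edges_nth[OF this]] show ?thesis by blast
      qed
      ultimately show "0 \<le> orient (pt a) (pt b) (pt v)" using left by auto
    qed (simp add: boundary_word_def)
  qed
  then show ?thesis
    using diagonal_dissectionI[OF P(1)] unfolding integer_area_diagonally_dissectable_def by blast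
qed

section \<open>Refining integer areas to unit areas\<close>

text \<open>If \<open>p\<close> is on the side from \<open>a\<close> to \<open>b\<close>, the piece
  over that side collapses to a segment whose two parts are sides of the other pieces. Those are
  nondegenerate since \<open>p\<close> is not a corner.\<close>

lemma degenerate_piece_covered:
  assumes pos: "0 < orient a b c" and p: "p \<in> convex hull {a, b, c}" "p \<notin> {a, b, c}"
    and "orient a b p = 0" "x \<in> convex hull {a, b, p}"
  shows "0 < orient b c p" "0 < orient c a p" "x \<in> convex hull {b, c, p} \<union> convex hull {c, a, p}"
proof -
  have rot: "0 < orient b c a" using pos by (simp add: orient_def algebra_simps)
  have "orient b c p \<noteq> 0" "orient c a p \<noteq> 0"
    using triangle_vertex_if_orient_0[OF _ _ pos, of p] triangle_vertex_if_orient_0[OF _ _ rot, of p]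
      assms(4) p(2) by auto
  then show "0 < orient b c p" "0 < orient c a p"
    using p(1) mem_triangle_iff[OF pos, of p] by simp_all
  have side: "p \<in> closed_segment a b" by (rule triangle_side_mem[OF pos p(1) assms(4)])
  then have "convex hull {a, b, p} \<subseteq> closed_segment a b"
    by (intro hull_minimal) auto
  then have "x \<in> closed_segment a p \<union> closed_segment p b"
    using assms(5) Un_closed_segment[OF side] by blast
  moreover have "closed_segment a p \<subseteq> convex hull {c, a, p}" "closed_segment p b \<subseteq> convex hull {b, c, p}"
    by (simp_all add: closed_segment_subset_convex_hull hull_inc)
  ultimately show "x \<in> convex hull {b, c, p} \<union> convex hull {c, a, p}" by blast
qed

lemma adjacent_pieces_disjoint:
  assumes "0 < orient u v p" "0 < orient v w p"
  shows "interior (convex hull {u, v, p}) \<inter> interior (convex hull {v, w, p}) = {}"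
proof -
  have "interior (convex hull {v, w, p}) \<inter> interior (convex hull {u, v, p}) = {}"
  proof (rule disjoint_interiors_if_separated[of v p])
    show "v \<noteq> p" using assms(1) by auto
    show "orient v p x \<le> 0" if "x \<in> convex hull {v, w, p}" for x
      using that mem_triangle_iff[OF assms(2), of x] orient_swap[of v p x] by simp
    show "0 \<le> orient v p x" if "x \<in> convex hull {u, v, p}" for x
      using that mem_triangle_iff[OF assms(1), of x] by simp
  qed
  then show ?thesis by blast
qed

text \<open>The condition \<open>0 < orient u v p\<close> drops the degenerate piece when
  \<open>p\<close> lies on a side, so that two or three triangles result.\<close>

lemma dissection_at_point:
  assumes pos: "0 < orient a b c" and p: "p \<in> convex hull {a, b, c}" "p \<notin> {a, b, c}"
  shows "dissection (convex hull {a, b, c})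
    ((\<lambda>(u, v). convex hull {u, v, p}) ` {(u, v) \<in> {(a, b), (b, c), (c, a)}. 0 < orient u v p})"
    (is "dissection ?T (?f ` ?S)")
proof -
  have rot: "0 < orient b c a" "0 < orient c a b"
    using pos by (simp_all add: orient_def algebra_simps)
  have rotT: "convex hull {b, c, a} = ?T" "convex hull {c, a, b} = ?T"
    by (simp_all add: insert_commute)
  have ne: "a \<noteq> b" "b \<noteq> c" "c \<noteq> a" using pos by auto
  have tri: "triangle (?f e)" if "e \<in> ?S" for e
  proof -
    have "orient (fst e) (snd e) p \<noteq> 0" using that by auto
    moreover have "?f e = convex hull {fst e, snd e, p}" by (simp add: case_prod_unfold)
    ultimately show ?thesis unfolding triangle_def collinear_iff_orient by blast
  qed
  have sub: "?f e \<subseteq> ?T" if "e \<in> ?S" for e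
  proof -
    have "fst e \<in> {a, b, c}" "snd e \<in> {a, b, c}" using that by auto
    then have "{fst e, snd e, p} \<subseteq> ?T" using p(1) by (simp add: hull_inc)
    then have "convex hull {fst e, snd e, p} \<subseteq> ?T" by (rule hull_minimal) (rule convex_convex_hull)
    then show ?thesis by (simp add: case_prod_unfold)
  qed
  have cover: "x \<in> \<Union>(?f ` ?S)" if x: "x \<in> ?T" for x
  proof -
    obtain v where "v \<in> {a, b, c}" "x \<in> convex hull (insert p ({a, b, c} - {v}))"
      using in_convex_hull_exchange[OF p(1) x] by blast
    moreover have "{a, b, c} - {a} = {b, c}" "{a, b, c} - {b} = {c, a}" "{a, b, c} - {c} = {a, b}"
      using ne by auto
    moreover have "insert p {b, c} = {b, c, p}" "insert p {c, a} = {c, a, p}" "insert p {a, b} = {a, b, p}"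
      by auto
    ultimately have x3: "x \<in> convex hull {a, b, p} \<or> x \<in> convex hull {b, c, p} \<or> x \<in> convex hull {c, a, p}"
      by (metis empty_iff insert_iff)
    have nonneg: "0 \<le> orient a b p" "0 \<le> orient b c p" "0 \<le> orient c a p"
      using p(1) mem_triangle_iff[OF pos, of p] by simp_all
    have "\<exists>e\<in>?S. x \<in> ?f e"
    proof -
      have p': "p \<in> convex hull {b, c, a}" "p \<notin> {b, c, a}" "p \<in> convex hull {c, a, b}" "p \<notin> {c, a, b}"
        using p rotT by auto
      have zero: "orient a b p = 0 \<or> 0 < orient a b p" "orient b c p = 0 \<or> 0 < orient b c p"
        "orient c a p = 0 \<or> 0 < orient c a p"
        using nonneg by linarith+
      note 1 = degenerate_piece_covered[OF pos p] and 2 = degenerate_piece_covered[OF rot(1) p'(1,2)]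
        and 3 = degenerate_piece_covered[OF rot(2) p'(3,4)]
      have "0 < orient a b p \<and> x \<in> convex hull {a, b, p} \<or> 0 < orient b c p \<and> x \<in> convex hull {b, c, p} \<or>
          0 < orient c a p \<and> x \<in> convex hull {c, a, p}"
        using x3 zero 1 2 3 by (metis Un_iff)
      then show ?thesis
        by (elim disjE) (rule bexI[of _ "(a, b)"] bexI[of _ "(b, c)"] bexI[of _ "(c, a)"]; simp)+
    qed
    then show ?thesis by blast
  qed
  have "interior (?f e) \<inter> interior (?f e') = {}" if "e \<in> ?S" "e' \<in> ?S" "?f e \<noteq> ?f e'" for e e'
  proof -
    have cases: "e \<in> {(a, b), (b, c), (c, a)}" "e' \<in> {(a, b), (b, c), (c, a)}"
      and pos: "0 < orient (fst e) (snd e) p" "0 < orient (fst e') (snd e') p"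
      using that by auto
    have "e \<noteq> e'" using that(3) by blast
    \<comment> \<open>Any two of the three sides are consecutive, so the corresponding pieces are
      separated by the line from their common corner to \<open>p\<close>.\<close>
    have "snd e = fst e' \<or> snd e' = fst e" using cases \<open>e \<noteq> e'\<close> by auto
    then have "interior (convex hull {fst e, snd e, p}) \<inter> interior (convex hull {fst e', snd e', p}) = {}"
      using pos adjacent_pieces_disjoint[of "fst e" "snd e" p "snd e'"]
        adjacent_pieces_disjoint[of "fst e'" "snd e'" p "snd e"] by (auto simp: Int_commute)
    then show ?thesis by (simp add: case_prod_unfold)
  qed
  then have "pairwise (\<lambda>S T. interior S \<inter> interior T = {}) (?f ` ?S)"
    unfolding pairwise_def by blast
  moreover have "\<Union>(?f ` ?S) = ?T" using cover sub by blast
  moreover have "finite (?f ` ?S)"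
    by (rule finite_imageI, rule finite_subset[of _ "{(a, b), (b, c), (c, a)}"]) auto
  ultimately show ?thesis unfolding dissection_def using tri by blast
qed

text \<open>
  The point is found by reducing a lattice point modulo the lattice spanned by two sides of the
  triangle: as that lattice has index greater than 1, one of the unit vectors is not in it.
\<close>

lemma lattice_point_in_triangle:
  assumes "1 < int_orient a b c"
  shows "\<exists>p. 0 \<le> int_orient a b p \<and> 0 \<le> int_orient b c p \<and> 0 \<le> int_orient c a p \<and>
    int_orient a b p < int_orient a b c \<and> int_orient b c p < int_orient a b c \<and>
    int_orient c a p < int_orient a b c"
proof -
  define u1 u2 v1 v2 where "u1 = fst b - fst a" "u2 = snd b - snd a" "v1 = fst c - fst a" "v2 = snd c - snd a"
  note uv = this
  define d where "d = int_orient a b c"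
  have d: "d = u1 * v2 - u2 * v1" by (simp add: d_def int_orient_def uv algebra_simps)
  have d1: "1 < d" using assms by (simp add: d_def)
  \<comment> \<open>By Cramer's rule \<open>(g1, g2)\<close> is in the lattice spanned by the sides
    iff \<open>d\<close> divides both determinants. If this held for both unit vectors,
    \<open>d\<close> would divide all four entries and \<open>d * d\<close> would divide the
    determinant \<open>d\<close>.\<close>
  have "\<exists>g1 g2. \<not> (d dvd g1 * v2 - g2 * v1 \<and> d dvd u1 * g2 - u2 * g1)"
  proof (rule ccontr)
    assume "\<not> ?thesis"
    then have all: "d dvd g1 * v2 - g2 * v1 \<and> d dvd u1 * g2 - u2 * g1" for g1 g2 by blast
    have "d dvd v2" "d dvd u2" "d dvd v1" "d dvd u1" using all[of 1 0] all[of 0 1] by simp_all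
    then have "d * d dvd u1 * v2 - u2 * v1" by (intro dvd_diff mult_dvd_mono)
    then have "d * d dvd d * 1" using d by simp
    then show False using d1 by (simp only: dvd_mult_cancel_left) simp
  qed
  then obtain g1 g2 where g: "\<not> (d dvd g1 * v2 - g2 * v1 \<and> d dvd u1 * g2 - u2 * g1)" by blast
  define s t where "s = g1 * v2 - g2 * v1" "t = u1 * g2 - u2 * g1"
  note st = this
  \<comment> \<open>Removing the integer parts of the coordinates \<open>s / d\<close> and
    \<open>t / d\<close> moves the vector into the half-open parallelogram spanned by the sides; it
    stays nonzero by the choice of \<open>g1\<close> and \<open>g2\<close>.\<close>
  define q1 q2 where "q1 = g1 - (s div d) * u1 - (t div d) * v1" "q2 = g2 - (s div d) * u2 - (t div d) * v2"
  note q = this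
  have "q1 * v2 - q2 * v1 = s - (s div d) * d"
    unfolding q st(1) d by (simp add: algebra_simps)
  then have qs: "q1 * v2 - q2 * v1 = s mod d" by (simp add: minus_div_mult_eq_mod)
  have "u1 * q2 - u2 * q1 = t - (t div d) * d"
    unfolding q st(2) d by (simp add: algebra_simps)
  then have qt: "u1 * q2 - u2 * q1 = t mod d" by (simp add: minus_div_mult_eq_mod)
  have bounds: "0 \<le> s mod d" "s mod d < d" "0 \<le> t mod d" "t mod d < d" using d1 by simp_all
  have nz: "\<not> (s mod d = 0 \<and> t mod d = 0)" using g by (simp add: st mod_eq_0_iff_dvd)
  have sum: "int_orient b c p = d - int_orient a b p - int_orient c a p" for p
    by (simp add: d_def int_orient_def algebra_simps)
  show ?thesis
  proof (cases "s mod d + t mod d \<le> d")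
    case True
    let ?p = "(fst a + q1, snd a + q2)"
    have "int_orient a b ?p = t mod d"
      unfolding qt[symmetric] by (simp add: int_orient_def uv algebra_simps)
    moreover have "int_orient c a ?p = s mod d"
      unfolding qs[symmetric] by (simp add: int_orient_def uv algebra_simps)
    moreover note sum[of ?p]
    ultimately show ?thesis
      using True bounds nz unfolding d_def[symmetric] by (intro exI[of _ ?p] conjI) linarith+
  next
    case False
    \<comment> \<open>The vector ended in the far half of the parallelogram; reflection in its
      centre brings the point into the triangle.\<close>
    let ?p = "(fst a + u1 + v1 - q1, snd a + u2 + v2 - q2)"
    have "int_orient a b ?p = d - (u1 * q2 - u2 * q1)"
      unfolding d by (simp add: int_orient_def uv algebra_simps)
    then have "int_orient a b ?p = d - t mod d" unfolding qt .
    moreover have "int_orient c a ?p = d - (q1 * v2 - q2 * v1)"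
      unfolding d by (simp add: int_orient_def uv algebra_simps)
    then have "int_orient c a ?p = d - s mod d" unfolding qs .
    moreover note sum[of ?p]
    ultimately show ?thesis
      using False bounds unfolding d_def[symmetric] by (intro exI[of _ ?p] conjI) linarith+
  qed
qed

text \<open>
  The map \<open>\<phi>\<close> parametrises an affine sublattice of index 2, in which area 1 becomes area 1/2:
  the triangle is split at lattice points until all pieces are unimodular.
\<close>

lemma unit_area_dissection:
  assumes \<phi>: "\<And>x y z. int_orient (\<phi> x) (\<phi> y) (\<phi> z) = 2 * int_orient x y z"
    and "0 < int_orient a b c"
  shows "\<exists>\<T>. dissection (convex hull {pt (\<phi> a), pt (\<phi> b), pt (\<phi> c)}) \<T> \<and>
    (\<forall>T\<in>\<T>. lattice_triangle T \<and> area T = 1)"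
  using assms(2)
proof (induction "nat (int_orient a b c)" arbitrary: a b c rule: less_induct)
  case less
  let ?T = "convex hull {pt (\<phi> a), pt (\<phi> b), pt (\<phi> c)}"
  have or: "orient (pt (\<phi> x)) (pt (\<phi> y)) (pt (\<phi> z)) = 2 * of_int (int_orient x y z)" for x y z
    by (simp add: orient_pt \<phi>)
  have pos: "0 < orient (pt (\<phi> a)) (pt (\<phi> b)) (pt (\<phi> c))" using less.prems by (simp add: or)
  show ?case
  proof (cases "int_orient a b c = 1")
    case True
    have "lattice_triangle ?T" using True by (intro lattice_triangleI) (simp add: \<phi>)
    moreover have "area ?T = 1" using True by (simp add: area_triangle or)
    moreover have "dissection ?T {?T}"
      using \<open>lattice_triangle ?T\<close> by (simp add: dissection_def lattice_triangle_def pairwise_def)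
    ultimately show ?thesis by blast
  next
    case False
    then have "1 < int_orient a b c" using less.prems by linarith
    \<comment> \<open>The strict upper bounds both exclude the corners and make every piece smaller
      than the triangle, as the induction requires.\<close>
    then obtain p where p: "0 \<le> int_orient a b p" "0 \<le> int_orient b c p" "0 \<le> int_orient c a p"
      "int_orient a b p < int_orient a b c" "int_orient b c p < int_orient a b c"
      "int_orient c a p < int_orient a b c"
      using lattice_point_in_triangle by blast
    let ?p = "pt (\<phi> p)"
    let ?S = "{(u, v) \<in> {(pt (\<phi> a), pt (\<phi> b)), (pt (\<phi> b), pt (\<phi> c)), (pt (\<phi> c), pt (\<phi> a))}. 0 < orient u v ?p}"
    have "?p \<in> ?T" using p mem_triangle_iff[OF pos, of ?p] by (simp add: or)
    moreover have "?p \<notin> {pt (\<phi> a), pt (\<phi> b), pt (\<phi> c)}"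
    proof
      have rot: "int_orient b c a = int_orient a b c" "int_orient c a b = int_orient a b c"
        by (simp_all add: int_orient_def algebra_simps)
      assume "?p \<in> {pt (\<phi> a), pt (\<phi> b), pt (\<phi> c)}"
      then have "\<phi> p = \<phi> a \<or> \<phi> p = \<phi> b \<or> \<phi> p = \<phi> c" by simp
      then show False
        using p(4-6) rot \<phi>[of a b p] \<phi>[of b c p] \<phi>[of c a p] \<phi>[of a b c] \<phi>[of b c a] \<phi>[of c a b] by auto
    qed
    ultimately have dis: "dissection ?T ((\<lambda>(u, v). convex hull {u, v, ?p}) ` ?S)"
      by (rule dissection_at_point[OF pos])
    have "\<exists>\<U>. dissection U \<U> \<and> (\<forall>T\<in>\<U>. lattice_triangle T \<and> area T = 1)"
      if U: "U \<in> (\<lambda>(u, v). convex hull {u, v, ?p}) ` ?S" for U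
    proof -
      from U consider "U = convex hull {pt (\<phi> a), pt (\<phi> b), ?p}" "0 < orient (pt (\<phi> a)) (pt (\<phi> b)) ?p"
        | "U = convex hull {pt (\<phi> b), pt (\<phi> c), ?p}" "0 < orient (pt (\<phi> b)) (pt (\<phi> c)) ?p"
        | "U = convex hull {pt (\<phi> c), pt (\<phi> a), ?p}" "0 < orient (pt (\<phi> c)) (pt (\<phi> a)) ?p"
        by auto
      then have "\<exists>x y. (x, y) \<in> {(a, b), (b, c), (c, a)} \<and> U = convex hull {pt (\<phi> x), pt (\<phi> y), ?p} \<and>
          0 < orient (pt (\<phi> x)) (pt (\<phi> y)) ?p"
        by cases blast+
      then obtain x y where xy: "(x, y) \<in> {(a, b), (b, c), (c, a)}"
        "U = convex hull {pt (\<phi> x), pt (\<phi> y), ?p}" "0 < orient (pt (\<phi> x)) (pt (\<phi> y)) ?p" by blast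
      have "0 < int_orient x y p" using xy(3) by (simp add: or)
      moreover have "int_orient x y p < int_orient a b c" using xy(1) p by auto
      ultimately show ?thesis unfolding xy(2) using less.hyps[of x y p] by simp
    qed
    then have "\<forall>U\<in>(\<lambda>(u, v). convex hull {u, v, ?p}) ` ?S.
        \<exists>\<U>. dissection U \<U> \<and> (\<forall>T\<in>\<U>. lattice_triangle T \<and> area T = 1)" by blast
    from bchoice[OF this] obtain f where f: "\<And>U. U \<in> (\<lambda>(u, v). convex hull {u, v, ?p}) ` ?S \<Longrightarrow>
        dissection U (f U) \<and> (\<forall>T\<in>f U. lattice_triangle T \<and> area T = 1)" by blast
    have "dissection ?T (\<Union>(f ` (\<lambda>(u, v). convex hull {u, v, ?p}) ` ?S))"
      by (rule dissection_refine[OF dis]) (use f in blast)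
    then show ?thesis using f by blast
  qed
qed

text \<open>Modulo 2 the two side vectors are linearly dependent, so one of the three nonzero
  functionals on the plane over the field with two elements (either coordinate or their sum) kills
  both. The three maps parametrise the preimages of the kernels, shifted to
  \<open>a\<close>.\<close>

lemma even_triangle_in_index_2_sublattice:
  assumes "even (int_orient a b c)"
  shows "\<exists>\<phi> a' b' c'. (\<forall>x y z. int_orient (\<phi> x) (\<phi> y) (\<phi> z) = 2 * int_orient x y z) \<and>
    a = \<phi> a' \<and> b = \<phi> b' \<and> c = \<phi> c'"
proof -
  define u1 u2 v1 v2 where "u1 = fst b - fst a" "u2 = snd b - snd a" "v1 = fst c - fst a" "v2 = snd c - snd a"
  note uv = this
  have bc: "b = (fst a + u1, snd a + u2)" "c = (fst a + v1, snd a + v2)" by (simp_all add: uv)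
  have "even (u1 * v2 - u2 * v1)" using assms by (simp add: int_orient_def uv)
  then consider "even u2" "even v2" | "even u1" "even v1" | "even (u2 - u1)" "even (v2 - v1)"
    by (cases "even u1"; cases "even u2"; cases "even v1"; cases "even v2") auto
  then show ?thesis
  proof cases
    case 1
    then obtain k l where "u2 = 2 * k" "v2 = 2 * l" by (auto elim!: evenE)
    then show ?thesis
      by (intro exI[of _ "\<lambda>z. (fst a + fst z, snd a + 2 * snd z)"]
          exI[of _ "(0, 0)"] exI[of _ "(u1, k)"] exI[of _ "(v1, l)"])
        (simp add: int_orient_def bc algebra_simps)
  next
    case 2
    then obtain k l where "u1 = 2 * k" "v1 = 2 * l" by (auto elim!: evenE)
    then show ?thesis
      by (intro exI[of _ "\<lambda>z. (fst a + 2 * fst z, snd a + snd z)"]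
          exI[of _ "(0, 0)"] exI[of _ "(k, u2)"] exI[of _ "(l, v2)"])
        (simp add: int_orient_def bc algebra_simps)
  next
    case 3
    then obtain k l where "u2 - u1 = 2 * k" "v2 - v1 = 2 * l" unfolding dvd_def by blast
    then have "u2 = u1 + 2 * k" "v2 = v1 + 2 * l" by simp_all
    then show ?thesis
      by (intro exI[of _ "\<lambda>z. (fst a + fst z, snd a + fst z + 2 * snd z)"]
          exI[of _ "(0, 0)"] exI[of _ "(u1, k)"] exI[of _ "(v1, l)"])
        (simp add: int_orient_def bc algebra_simps)
  qed
qed

theorem integer_imp_unit_area_dissectable:
  assumes "integer_area_dissectable P"
  shows "unit_area_dissectable P"
proof -
  obtain \<T> where \<T>: "dissection P \<T>" "\<forall>T\<in>\<T>. lattice_triangle T \<and> area T \<in> \<int>"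
    using assms by (auto simp: integer_area_dissectable_def)
  have "\<forall>T\<in>\<T>. \<exists>\<U>. dissection T \<U> \<and> (\<forall>U\<in>\<U>. lattice_triangle U \<and> area U = 1)"
  proof
    fix T assume "T \<in> \<T>"
    with \<T>(2) have T: "lattice_triangle T" "area T \<in> \<int>" by auto
    obtain a b c where abc: "0 < int_orient a b c" "T = convex hull {pt a, pt b, pt c}"
      using T(1) by (rule lattice_triangleE)
    then have "even (int_orient a b c)"
      using T(2) integer_area_iff[of a b c] even_int_orient_iff[of a b c] by simp
    then obtain \<phi> a' b' c' where \<phi>: "\<And>x y z. int_orient (\<phi> x) (\<phi> y) (\<phi> z) = 2 * int_orient x y z"
      "a = \<phi> a'" "b = \<phi> b'" "c = \<phi> c'"
      using even_triangle_in_index_2_sublattice[of a b c] by blast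
    have "0 < int_orient a' b' c'" using abc(1) \<phi>(1)[of a' b' c'] \<phi>(2-) by simp
    from unit_area_dissection[of \<phi>, OF \<phi>(1) this]
    show "\<exists>\<U>. dissection T \<U> \<and> (\<forall>U\<in>\<U>. lattice_triangle U \<and> area U = 1)"
      unfolding abc(2) \<phi>(2-) .
  qed
  from bchoice[OF this] obtain f where f: "\<And>T. T \<in> \<T> \<Longrightarrow>
      dissection T (f T) \<and> (\<forall>U\<in>f T. lattice_triangle U \<and> area U = 1)" by blast
  have "dissection P (\<Union>(f ` \<T>))" by (rule dissection_refine[OF \<T>(1)]) (use f in blast)
  then show ?thesis unfolding unit_area_dissectable_def using f by blast
qed

section \<open>Equivalence of the conditions and the decision procedure\<close>

text \<open>Integer-area dissectability is the hub: unit-area and diagonal dissections are instances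
  of it, and it implies contractibility, which returns a diagonal dissection.\<close>

lemma conditions_equivalent:
  assumes "convex_lattice_polygon P" "ccw_vertex_list P vs"
  shows "vs \<noteq> []"
    and "integer_area_dissectable P \<longleftrightarrow> contractible_word (boundary_word vs)"
    and "integer_area_diagonally_dissectable P \<longleftrightarrow> contractible_word (boundary_word vs)"
    and "unit_area_dissectable P \<longleftrightarrow> contractible_word (boundary_word vs)"
proof -
  have P: "polytope P" "interior P \<noteq> {}" using assms(1) by (auto simp: convex_lattice_polygon_def)
  have conv: "convex P" "compact P" using P polytope_imp_convex polytope_imp_compact by auto
  have "P = convex hull (pt ` set vs)"
    using assms(2) Krein_Milman_Minkowski[OF conv(2,1)] by (simp add: ccw_vertex_list_def vertices_def)
  then show ne: "vs \<noteq> []" using P(2) by auto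
  have 1: "unit_area_dissectable P \<Longrightarrow> integer_area_dissectable P"
    by (auto simp: unit_area_dissectable_def integer_area_dissectable_def)
  have 3: "integer_area_diagonally_dissectable P \<Longrightarrow> integer_area_dissectable P"
    by (auto simp: integer_area_diagonally_dissectable_def integer_area_dissectable_def
        diagonal_dissection_def)
  note rest = integer_imp_unit_area_dissectable
    integer_dissection_imp_contractible[OF conv(1) _ assms(2) ne]
    contractible_imp_diagonally_dissectable[OF assms]
  show "integer_area_dissectable P \<longleftrightarrow> contractible_word (boundary_word vs)"
    "integer_area_diagonally_dissectable P \<longleftrightarrow> contractible_word (boundary_word vs)"
    "unit_area_dissectable P \<longleftrightarrow> contractible_word (boundary_word vs)"
    using 1 3 rest by blast+
qed

theorem theorem4:
  shows "(\<forall>P vs. convex_lattice_polygon P \<and> ccw_vertex_list P vs \<longrightarrow>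
            (unit_area_dissectable P \<longleftrightarrow> integer_area_dissectable P) \<and>
            (integer_area_dissectable P \<longleftrightarrow> integer_area_diagonally_dissectable P) \<and>
            (integer_area_diagonally_dissectable P \<longleftrightarrow> contractible_word (boundary_word vs))) \<and>
         (\<exists>prog c. \<forall>P vs. convex_lattice_polygon P \<and> ccw_vertex_list P vs \<longrightarrow>
            (\<exists>accept. halts_within prog vs (c * length vs) accept \<and>
               (accept \<longleftrightarrow>
                  unit_area_dissectable P \<and> integer_area_dissectable P \<and>
                  integer_area_diagonally_dissectable P \<and>
                  contractible_word (boundary_word vs))))"
proof (intro conjI)
  show "\<exists>prog c. \<forall>P vs. convex_lattice_polygon P \<and> ccw_vertex_list P vs \<longrightarrow>
            (\<exists>accept. halts_within prog vs (c * length vs) accept \<and>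
               (accept \<longleftrightarrow>
                  unit_area_dissectable P \<and> integer_area_dissectable P \<and>
                  integer_area_diagonally_dissectable P \<and>
                  contractible_word (boundary_word vs)))"
  proof (rule exI[of _ stack_program], rule exI[of _ 13], intro allI impI, elim conjE)
    fix P vs assume P: "convex_lattice_polygon P" "ccw_vertex_list P vs"
    have "boundary_word vs \<noteq> []"
      using conditions_equivalent(1)[OF P] by (simp add: boundary_word_def)
    then show "\<exists>accept. halts_within stack_program vs (13 * length vs) accept \<and>
               (accept \<longleftrightarrow>
                  unit_area_dissectable P \<and> integer_area_dissectable P \<and>
                  integer_area_diagonally_dissectable P \<and>
                  contractible_word (boundary_word vs))"
      using stack_program_correct[OF conditions_equivalent(1)[OF P]] conditions_equivalent(2-)[OF P]
        contractible_iff_run_stack by blast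
  qed
qed (use conditions_equivalent in blast)

end
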